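(* Fix real numbers $K>3$ and $\rho>2$, and let $y=y(x)$ be a function of $x$ satisfying $y=(\log x)^{K+o(1)}$ as $x\to\infty$. Put $\kappa=1/K$ and $\beta=(1-3\kappa)/4$, and suppose that $\beta\rho>1/2$. Then, as $x\to\infty$, \[ I_\rho(x,y)\le x^{o(1)}\left(\Psi(x,y)^{\rho}x^{-1}+\Psi(x,y)^{\rho}x^{-\beta\rho}+\Psi(x,y)\,x^{3(\rho-2)/4}\right). \]
   Context: For $0\le y\le x$, let $\mathcal S(x,y)$ be the set of integers $1\le n\le x$ all of whose prime factors $p$ satisfy $p\le y$ (the $y$-smooth numbers up to $x$), and $\Psi(x,y)=\#\mathcal S(x,y)$. For $\vartheta\in[0,1]$ let $S(\vartheta;x,y)=\sum_{n\in\mathcal S(x,y)}\mathbf e(\vartheta n)$, where $\mathbf e(s)=e^{2\pi i s}$, and for $\rho>2$ let $I_\rho(x,y)=\int_0^1|S(\vartheta;x,y)|^\rho\,d\vartheta$. The notation $x^{o(1)}$ denotes a quantity which, for every fixed $\varepsilon>0$, is bounded in absolute value by $x^{\varepsilon}$ for all sufficiently large $x$ (the implied thresholds may depend on $K$, $\rho$ and the function $y$); more generally $o(1)$ denotes a quantity tending to $0$ as $x\to\infty$. *)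

theory Defs
  imports "HOL-Analysis.Analysis" "HOL-Computational_Algebra.Primes"
begin

definition smooth_numbers :: "real \<Rightarrow> real \<Rightarrow> nat set" where
  "smooth_numbers x y =
     {n. 1 \<le> n \<and> real n \<le> x \<and> (\<forall>p. prime p \<and> p dvd n \<longrightarrow> real p \<le> y)}"

definition smooth_count :: "real \<Rightarrow> real \<Rightarrow> nat" where
  "smooth_count x y = card (smooth_numbers x y)"

definition add_char :: "real \<Rightarrow> complex" where
  "add_char s = exp (2 * complex_of_real pi * \<i> * complex_of_real s)"

definition smooth_exp_sum :: "real \<Rightarrow> real \<Rightarrow> real \<Rightarrow> complex" where
  "smooth_exp_sum \<theta> x y = (\<Sum>n\<in>smooth_numbers x y. add_char (\<theta> * real n))"

definition smooth_moment :: "real \<Rightarrow> real \<Rightarrow> real \<Rightarrow> real" where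
  "smooth_moment \<rho> x y = integral {0..1} (\<lambda>\<theta>. norm (smooth_exp_sum \<theta> x y) powr \<rho>)"

text \<open>The factor written $x^{o(1)}$: a real function of $x$ that is eventually at most
  $x^\varepsilon$ in absolute value, for every fixed $\varepsilon > 0$.\<close>

definition subpolynomial :: "(real \<Rightarrow> real) \<Rightarrow> bool" where
  "subpolynomial g \<longleftrightarrow> (\<forall>\<epsilon>>0. eventually (\<lambda>x. \<bar>g x\<bar> \<le> x powr \<epsilon>) at_top)"

end

theory Submission
  imports Defs "HOL-Real_Asymp.Real_Asymp"
begin

text \<open>
  Write \<open>\<theta> = a / q + \<delta>\<close> by Dirichlet's theorem, with \<open>q \<le> sqrt x\<close> and \<open>T = q * (1 + \<bar>\<delta>\<bar> * x) \<le> 4 * sqrt x\<close>,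
  and put \<open>\<sigma> = 1 - 1 / K\<close>. The pointwise bound is \<open>\<bar>S(\<theta>)\<bar> \<le> x powr o(1) * \<Psi>(x, y) * T powr (- 2 * \<beta>)\<close>.
  Smooth numbers factor as \<open>n = m * l\<close> with \<open>m\<close> between \<open>M\<close> and \<open>M * y\<close>, where \<open>M\<close> is about \<open>4 * T\<close>;
  by Cauchy-Schwarz in \<open>m\<close>, with the smoothness of \<open>m\<close> dropped, \<open>\<bar>S\<bar>\<^sup>2\<close> is controlled by geometric
  sums with ratios \<open>e(\<theta> * (l - l'))\<close>. For given \<open>l\<close> and up to an error \<open>1 / M\<close> in the fractional part of
  \<open>\<theta> * (l - l')\<close>, the number \<open>l'\<close> lies in a fixed residue class modulo \<open>q\<close> and in a short interval, which
  leaves about \<open>\<Psi>(x / T\<^sup>2, y)\<close> possibilities. Rankin's method bounds these counts by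
  \<open>\<Psi>(z, y) \<le> x powr o(1) * z powr \<sigma>\<close>, and Chebyshev's lower bound for the number of primes gives
  \<open>\<Psi>(x, y) \<ge> x powr (\<sigma> - o(1))\<close>.

  Since \<open>2 * \<beta> * \<rho> > 1\<close>, integrating \<open>T powr (- 2 * \<beta> * \<rho>)\<close> around \<open>a / q\<close> gives
  \<open>O(q powr (- 2 * \<beta> * \<rho>) / x)\<close>, and summing over \<open>a\<close> and \<open>q \<le> sqrt x\<close> yields the first two terms of
  the bound.
\<close>

section \<open>Factorizations of smooth numbers\<close>

lemma finite_smooth_numbers [simp]: "finite (smooth_numbers x y)"
proof (rule finite_subset)
  show "smooth_numbers x y \<subseteq> {..nat \<lfloor>x\<rfloor>}"
    by (auto simp: smooth_numbers_def le_nat_floor)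
qed simp

lemma smooth_numbers_dvd:
  assumes "n \<in> smooth_numbers x y" "d dvd n" "real d \<le> z"
  shows "d \<in> smooth_numbers z y"
  using assms unfolding smooth_numbers_def
  by (auto intro: dvd_trans Nat.gr0I simp: Suc_le_eq)

text \<open>The greatest prime factor, a junk value for \<open>n \<le> 1\<close>.\<close>

definition gpf :: "nat \<Rightarrow> nat" where
  "gpf n = Max (prime_factors n)"

lemma
  assumes "n > 1"
  shows prime_gpf: "prime (gpf n)" and gpf_dvd: "gpf n dvd n"
proof -
  obtain p where "prime p" "p dvd n"
    using assms prime_factor_nat[of n] by auto
  hence "p \<in> prime_factors n"
    using assms by (auto simp: prime_factors_dvd)
  hence "gpf n \<in> prime_factors n"
    unfolding gpf_def by (intro Max_in) blast+
  thus "prime (gpf n)" "gpf n dvd n"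
    by auto
qed

lemma le_gpf: "prime p \<Longrightarrow> p dvd n \<Longrightarrow> n > 0 \<Longrightarrow> p \<le> gpf n"
  unfolding gpf_def by (intro Max_ge) (auto simp: prime_factors_dvd)

lemma gpf_mono: "m dvd n \<Longrightarrow> m > 1 \<Longrightarrow> n > 0 \<Longrightarrow> gpf m \<le> gpf n"
  using le_gpf prime_gpf gpf_dvd by (meson dvd_trans)

lemma div_gpf_less: "n > 1 \<Longrightarrow> n div gpf n < n"
  using prime_gpf[of n] prime_gt_1_nat by auto

text \<open>\<open>n \<mapsto> (lead M n, n div lead M n)\<close> is a bijection from the \<open>n \<ge> M\<close> onto the pairs \<open>(m, l)\<close> such that
  \<open>m div gpf m < M \<le> m\<close> and no prime factor of \<open>l\<close> is below \<open>gpf m\<close>; the only coupling between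
  \<open>m\<close> and \<open>l\<close> is through the prime \<open>gpf m\<close>.\<close>

function lead :: "nat \<Rightarrow> nat \<Rightarrow> nat" where
  "lead M n = (if n \<le> 1 \<or> n div gpf n < M then n else lead M (n div gpf n))"
  by auto
termination
  by (relation "Wellfounded.measure snd") (auto simp: div_gpf_less)

declare lead.simps [simp del]

text \<open>Greatest prime factors are stripped off one at a time for as long as the quotient stays
  at least \<open>M\<close>. The stripped primes never increase, so each is at least the greatest
  prime of what is left; this is the condition on the cofactor.\<close>

lemma lead_properties:
  assumes "2 \<le> M" "M \<le> n"
  shows "M \<le> lead M n \<and> lead M n dvd n \<and> lead M n div gpf (lead M n) < M \<and>
         (\<forall>r. prime r \<longrightarrow> r dvd n div lead M n \<longrightarrow> gpf (lead M n) \<le> r)"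
  using assms
proof (induction M n rule: lead.induct)
  case (1 M n)
  define n' where "n' = n div gpf n"
  have n: "n > 1" "n > 0" using 1 by auto
  show ?case
  proof (cases "n' < M")
    case True
    hence "lead M n = n" using n by (subst lead.simps) (auto simp: n'_def)
    thus ?thesis using 1 n True by (auto simp: n'_def)
  next
    case False
    hence l: "lead M n = lead M n'" using n by (subst lead.simps) (auto simp: n'_def)
    have nn: "n = gpf n * n'" using gpf_dvd[OF n(1)] by (simp add: n'_def)
    have IH: "M \<le> lead M n'" "lead M n' dvd n'" "lead M n' div gpf (lead M n') < M"
         "\<And>r. prime r \<Longrightarrow> r dvd n' div lead M n' \<Longrightarrow> gpf (lead M n') \<le> r"
      using 1 n False by (auto simp: n'_def)
    have "gpf (lead M n') \<le> r" if r: "prime r" "r dvd n div lead M n'" for r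
    proof -
      have "n div lead M n' = gpf n * (n' div lead M n')"
        using IH(2) nn by (metis div_mult_swap)
      hence "r dvd gpf n \<or> r dvd n' div lead M n'"
        using r by (simp add: prime_dvd_mult_iff)
      moreover have "r = gpf n" if "r dvd gpf n"
        using that r(1) prime_gpf[OF n(1)] primes_dvd_imp_eq by blast
      moreover have "gpf (lead M n') \<le> gpf n"
        proof (rule gpf_mono)
        show "lead M n' dvd n" by (subst nn) (rule dvd_mult[OF IH(2)])
      qed (use IH(1) 1 n in auto)
      ultimately show ?thesis using IH(4) r by blast
    qed
    moreover have "lead M n' dvd n" by (subst nn) (rule dvd_mult[OF IH(2)])
    ultimately show ?thesis unfolding l using IH(1,3) by blast
  qed
qed

text \<open>Converse of \<open>lead_properties\<close>. No prime of \<open>l\<close> is below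
  \<open>gpf m\<close>, so \<open>m * l\<close> and \<open>l\<close> have the same greatest prime
  factor while \<open>l > 1\<close>. The recursion therefore consumes \<open>l\<close> prime by
  prime and stops exactly at \<open>m\<close>.\<close>

lemma lead_mult_eq:
  assumes "2 \<le> M" "M \<le> m" "m div gpf m < M" "l > 0"
    and "\<And>r. prime r \<Longrightarrow> r dvd l \<Longrightarrow> gpf m \<le> r"
  shows "lead M (m * l) = m"
  using assms(4,5)
proof (induction l rule: less_induct)
  case (less l)
  show ?case
  proof (cases "l = 1")
    case True
    thus ?thesis using assms by (subst lead.simps) auto
  next
    case False
    hence l: "l > 1" using less by auto
    have m: "m > 1" using assms by auto
    have ml: "m * l > 1" using l m by (metis less_1_mult)
    have g: "gpf (m * l) = gpf l"
    proof (rule antisym)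
      have "gpf (m * l) dvd m \<or> gpf (m * l) dvd l"
        using prime_gpf[OF ml] gpf_dvd[OF ml] prime_dvd_mult_iff by blast
      moreover have "gpf m \<le> gpf l"
        using less.prems prime_gpf[OF l] gpf_dvd[OF l] by blast
      ultimately show "gpf (m * l) \<le> gpf l"
        using le_gpf[OF prime_gpf[OF ml], of m] le_gpf[OF prime_gpf[OF ml], of l] l m by linarith
      show "gpf l \<le> gpf (m * l)"
        using l m by (intro gpf_mono) auto
    qed
    define l' where "l' = l div gpf l"
    have ll: "l = gpf l * l'" using gpf_dvd[OF l] by (simp add: l'_def)
    have l': "l' < l" "l' > 0" using l div_gpf_less[OF l] ll by (auto simp: l'_def intro: Nat.gr0I)
    have d: "m * l div gpf (m * l) = m * l'"
      unfolding g l'_def using gpf_dvd[OF l] by (simp add: div_mult_swap)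
    have "M \<le> m * l'" using l' assms(2) by (auto intro: order.trans)
    hence "lead M (m * l) = lead M (m * l')"
      using ml by (subst lead.simps) (auto simp: d)
    also have "\<dots> = m"
    proof (rule less.IH)
      fix r assume "prime r" "r dvd l'"
      thus "gpf m \<le> r" using less.prems(2) ll by (metis dvd_mult)
    qed (use l' in auto)
    finally show ?thesis .
  qed
qed

text \<open>Take \<open>lead W n\<close>: dividing out one prime, of size at most \<open>y\<close>,
  brings it below \<open>W\<close>, so it is at most \<open>W * y\<close>. When
  \<open>n < W\<close>, the number \<open>n\<close> itself serves.\<close>

lemma smooth_divisor_exists:
  assumes "2 \<le> W" "n \<in> smooth_numbers x y" "1 \<le> y"
  obtains k where "k dvd n" "k \<in> smooth_numbers (real W * y) y" "k \<ge> W \<or> k = n"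
proof (cases "n < W")
  case True
  have "real n \<le> real W" using True by simp
  also have "\<dots> \<le> real W * y" using assms by (simp add: mult_le_cancel_left1)
  finally show ?thesis using True assms smooth_numbers_dvd[of n x y n] by (intro that[of n]) auto
next
  case False
  define k where "k = lead W n"
  have k: "W \<le> k" "k dvd n" "k div gpf k < W"
    using lead_properties[of W n] False assms by (auto simp: k_def)
  have k1: "k > 1" using k assms by auto
  have "k = gpf k * (k div gpf k)" using gpf_dvd[OF k1] by simp
  hence "real k = real (gpf k) * real (k div gpf k)" by (metis of_nat_mult)
  also have "\<dots> \<le> y * real W"
  proof (intro mult_mono)
    show "real (gpf k) \<le> y"
      using assms(2) prime_gpf[OF k1] gpf_dvd[OF k1] k(2) unfolding smooth_numbers_def
      by (blast intro: dvd_trans)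
  qed (use k assms in auto)
  finally show ?thesis
    using k assms by (intro that[of k] smooth_numbers_dvd[of n x y k]) (auto simp: mult_ac)
qed

section \<open>Counting smooth numbers\<close>

lemma smooth_count_step:
  assumes "prime p" 
  shows "smooth_count z (real p) \<le> smooth_count z (real (p - 1)) + smooth_count (z / real p) (real p)"
proof -
  have p: "p > 0" using assms prime_gt_0_nat by auto
  have "smooth_numbers z (real p) \<subseteq>
          smooth_numbers z (real (p - 1)) \<union> (*) p ` smooth_numbers (z / real p) (real p)"
  proof
    fix n assume n: "n \<in> smooth_numbers z (real p)"
    show "n \<in> smooth_numbers z (real (p - 1)) \<union> (*) p ` smooth_numbers (z / real p) (real p)"
    proof (cases "p dvd n")
      case True
      then obtain m where m: "n = p * m" by auto
      have "m \<in> smooth_numbers (z / real p) (real p)"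
      proof (rule smooth_numbers_dvd[OF n])
        have "real p * real m \<le> z" using n by (simp add: smooth_numbers_def m)
        thus "real m \<le> z / real p" using p by (simp add: field_simps)
      qed (simp add: m)
      thus ?thesis using m by auto
    next
      case False
      have "real q \<le> real (p - 1)" if "prime q" "q dvd n" for q
      proof -
        have "q \<le> p" "q \<noteq> p" using that n False by (auto simp: smooth_numbers_def)
        thus ?thesis by auto
      qed
      thus ?thesis using n by (auto simp: smooth_numbers_def)
    qed
  qed
  hence "smooth_count z (real p) \<le>
      card (smooth_numbers z (real (p - 1)) \<union> (*) p ` smooth_numbers (z / real p) (real p))"
    unfolding smooth_count_def by (intro card_mono) auto
  also have "\<dots> \<le> smooth_count z (real (p - 1)) + smooth_count (z / real p) (real p)"
    unfolding smooth_count_def by (intro order.trans[OF card_Un_le] add_mono card_image_le) auto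
  finally show ?thesis .
qed

lemma smooth_count_less_1: "z < 1 \<Longrightarrow> smooth_count z y = 0"
  unfolding smooth_count_def by (subst card_eq_0_iff) (auto simp: smooth_numbers_def)

text \<open>Rankin's bound with the Euler product enlarged to all integers from 2 to
  \<open>k\<close>. The factors at composite \<open>j\<close> exceed 1 and only weaken the bound,
  and sums over primes are thereby replaced by sums over integers.\<close>

lemma smooth_count_le_prod:
  assumes s: "s > 0" and z: "z > 0"
  shows "real (smooth_count z (real k)) \<le> z powr s * (\<Prod>j=2..k. 1 / (1 - real j powr (-s)))"
  using z
proof (induction k arbitrary: z)
  case 0
  show ?case
  proof (cases "z < 1")
    case False
    have "smooth_numbers z 0 \<subseteq> {1}"
    proof
      fix n assume n: "n \<in> smooth_numbers z 0"
      have "n = 1"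
      proof (rule ccontr)
        assume "n \<noteq> 1"
        then obtain p where "prime p" "p dvd n" using prime_factor_nat by blast
        hence "real p \<le> 0" "p > 0" using n prime_gt_0_nat by (auto simp: smooth_numbers_def)
        thus False by simp
      qed
      thus "n \<in> {1}" by simp
    qed
    hence "smooth_count z 0 \<le> card {1::nat}" unfolding smooth_count_def by (intro card_mono) auto
    moreover have "z powr s \<ge> 1" using False s by (simp add: ge_one_powr_ge_zero)
    ultimately show ?thesis by simp
  qed (auto simp: smooth_count_less_1)
next
  case (Suc k)
  let ?c = "\<lambda>k. \<Prod>j=2..k. 1 / (1 - real j powr (-s))"
  have less1: "real j powr (-s) < 1" if "j \<ge> 2" for j
    using gr_one_powr[of "real j" s] that s by (simp add: powr_minus_divide)
  have pos: "?c k > 0" for k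
    using less1 by (intro prod_pos) (auto simp: less_diff_eq)
  show ?case
  proof (cases "prime (Suc k)")
    case False
    have "smooth_numbers z (real (Suc k)) = smooth_numbers z (real k)"
    proof -
      have "(real p \<le> real (Suc k)) = (real p \<le> real k)" if "prime p" for p
        using that False le_Suc_eq[of p k] by (auto simp del: of_nat_Suc)
      thus ?thesis unfolding smooth_numbers_def by (auto simp del: of_nat_Suc)
    qed
    hence "real (smooth_count z (real (Suc k))) \<le> z powr s * ?c k"
      unfolding smooth_count_def using Suc by (simp add: smooth_count_def)
    also have "?c k \<le> ?c (Suc k)"
    proof (cases "Suc k \<ge> 2")
      case True
      hence "?c (Suc k) = ?c k * (1 / (1 - real (Suc k) powr (-s)))"
        by (subst prod.nat_ivl_Suc') (auto simp: mult_ac)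
      moreover have "1 / (1 - real (Suc k) powr (-s)) \<ge> 1"
        using less1[OF True] by (simp add: field_simps)
      ultimately show ?thesis using pos[of k] by (metis mult_le_cancel_left1 not_less_iff_gr_or_eq)
    qed auto
    finally show ?thesis by (simp add: mult_left_mono)
  next
    case True
    define p where "p = Suc k"
    have p: "prime p" "p \<ge> 2" "k = p - 1" using True prime_ge_2_nat[of "Suc k"] by (auto simp: p_def)
    \<comment> \<open>This identity makes Buchstab's recursion close without loss: the two terms add
      up to exactly \<open>z powr s * ?c p\<close>.\<close>
    have c: "?c p * (1 - real p powr (-s)) = ?c k"
    proof -
      have "?c p = ?c k * (1 / (1 - real p powr (-s)))"
        unfolding p_def using p(2) by (subst prod.nat_ivl_Suc') (auto simp: mult_ac p_def)
      thus ?thesis using less1[OF p(2)] by simp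
    qed
    \<comment> \<open>The recursion refers to the bound for the same prime at \<open>z / p\<close>.
      A second induction, on the exponent of a power of two above \<open>z\<close>, supplies it
      because \<open>p\<close> is at least 2; the hypothesis on \<open>k\<close> is kept as
      \<open>outer\<close>.\<close>
    note outer = Suc.IH
    have "\<forall>z>0. z < 2 ^ i \<longrightarrow> real (smooth_count z (real p)) \<le> z powr s * ?c p" for i
    proof (induction i)
      case 0
      show ?case using pos[of p] by (auto simp: smooth_count_less_1 less_imp_le)
    next
      case (Suc i)
      show ?case
      proof safe
        fix z :: real assume z: "z > 0" "z < 2 ^ Suc i"
        have "z / real p \<le> z / 2" using z p by (intro divide_left_mono) auto
        moreover have "z / 2 < 2 ^ i" using z(2) by simp
        ultimately have zp: "z / real p < 2 ^ i" by linarith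
        have zp': "z / real p > 0" using z p by simp
        have "real (smooth_count z (real p)) \<le>
               real (smooth_count z (real k)) + real (smooth_count (z / real p) (real p))"
          using smooth_count_step[OF p(1), of z, folded p(3)]
          by (simp flip: of_nat_add)
        also have "\<dots> \<le> z powr s * ?c k + (z / real p) powr s * ?c p"
          using Suc zp zp' by (intro add_mono outer[OF z(1)]) auto
        also have "(z / real p) powr s = z powr s * real p powr (-s)"
          using z p by (simp add: powr_divide powr_minus field_simps)
        also have "z powr s * ?c k + z powr s * real p powr (-s) * ?c p = z powr s * ?c p"
          unfolding c[symmetric] by (simp add: algebra_simps)
        finally show "real (smooth_count z (real p)) \<le> z powr s * ?c p" .
      qed
    qed
    moreover obtain i where "z < 2 ^ i" using real_arch_pow[of 2 z] by auto
    ultimately show ?thesis using Suc.prems by (auto simp: p_def)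
  qed
qed

section \<open>Chebyshev's lower bound for the number of primes\<close>

text \<open>The numbers \<open>1 / ((n + 1) * (n choose k))\<close> form Leibniz's harmonic triangle, in which every entry
  is a difference of two others; this gives integrality by induction on \<open>k\<close>.\<close>

lemma Lcm_triangle:
  assumes "k \<le> n"
  shows "real (Lcm {1..Suc n}) / (real (Suc n) * real (n choose k)) \<in> \<int>"
  using assms
proof (induction k arbitrary: n)
  case 0
  have "Suc n dvd Lcm {1..Suc n}" by (intro dvd_Lcm) auto
  then obtain c where "Lcm {1..Suc n} = Suc n * c" by (elim dvdE)
  hence "real (Lcm {1..Suc n}) / (real (Suc n) * real (n choose 0)) = real c"
    unfolding \<open>Lcm {1..Suc n} = Suc n * c\<close> of_nat_mult by (simp del: of_nat_Suc)
  thus ?case by simp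
next
  case (Suc k)
  then obtain m where m: "n = Suc m" "k \<le> m" by (cases n) auto
  have pos: "real (m choose k) > 0" "real (Suc m choose k) > 0" "real (Suc m choose Suc k) > 0"
    unfolding of_nat_0_less_iff zero_less_binomial_iff using m Suc.prems by auto
  have A: "real (Suc m choose k) * (real m + 1 - real k) = (real m + 1) * real (m choose k)"
  proof -
    have "(Suc m choose k) * (Suc m - k) = Suc m * (m choose k)"
      using binomial_absorb_comp[of "Suc m" k] by (simp add: mult_ac)
    hence "real (Suc m choose k) * real (Suc m - k) = real (Suc m) * real (m choose k)"
      unfolding of_nat_mult[symmetric] by simp
    moreover have "real (Suc m - k) = real m + 1 - real k" using m by (simp add: of_nat_diff)
    ultimately show ?thesis by simp
  qed
  have B: "(real k + 1) * real (Suc m choose Suc k) = (real m + 1) * real (m choose k)"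
    using Suc_times_binomial_eq[of m k, THEN arg_cong[where f = real]] by (simp add: algebra_simps)
  define C where "C = real (m choose k)"
  define t where "t = real m + 1 - real k"
  have t: "t > 0" "C > 0" using m pos by (auto simp: t_def C_def)
  have A': "real (Suc m choose k) = (real m + 1) * C / t" using A t by (simp add: C_def t_def field_simps)
  have B': "real (Suc m choose Suc k) = (real m + 1) * C / (real k + 1)" using B by (simp add: C_def field_simps)
  have leibniz: "1 / ((real m + 2) * real (Suc m choose Suc k)) =
        1 / ((real m + 1) * real (m choose k)) - 1 / ((real m + 2) * real (Suc m choose k))"
  proof -
    define D where "D = (real m + 2) * (real m + 1) * C"
    have "1 / ((real m + 2) * real (Suc m choose Suc k)) = (real k + 1) / D"
      unfolding B' D_def using t by simp
    moreover have "1 / ((real m + 2) * real (Suc m choose k)) = t / D"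
      unfolding A' D_def using t by simp
    moreover have "1 / ((real m + 1) * real (m choose k)) = (real m + 2) / D"
      unfolding C_def[symmetric] D_def using t by simp
    moreover have "real k + 1 = real m + 2 - t" by (simp add: t_def)
    ultimately show ?thesis by (simp only: diff_divide_distrib)
  qed
  have "real (Lcm {1..Suc n}) / (real (Suc n) * real (n choose Suc k)) =
        real (Lcm {1..Suc n}) / (real (Suc m) * real (m choose k)) -
        real (Lcm {1..Suc n}) / (real (Suc n) * real (n choose k))"
  proof -
    have "real (Suc n) = real m + 2" "real (Suc m) = real m + 1" by (auto simp: m)
    thus ?thesis
      using arg_cong[OF leibniz, of "\<lambda>u. real (Lcm {1..Suc n}) * u"]
      unfolding m(1)[symmetric] by (simp only: right_diff_distrib times_divide_eq_right mult_1_right)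
  qed
  moreover have "real (Lcm {1..Suc n}) / (real (Suc m) * real (m choose k)) \<in> \<int>"
  proof -
    have "Lcm {1..Suc m} dvd Lcm {1..Suc n}" unfolding m by (intro Lcm_subset) auto
    then obtain c where "Lcm {1..Suc n} = Lcm {1..Suc m} * c" by auto
    hence "real (Lcm {1..Suc n}) / (real (Suc m) * real (m choose k)) =
        real (Lcm {1..Suc m}) / (real (Suc m) * real (m choose k)) * real c" by simp
    thus ?thesis using Suc.IH[OF m(2)] by (metis Ints_mult Ints_of_nat)
  qed
  ultimately show ?case using Suc.IH[of n] Suc.prems by (metis Ints_diff Suc_leD)
qed

text \<open>The middle entry of Leibniz's triangle shows that
  \<open>(2 * n + 1) * (2 * n choose n)\<close> divides the least common multiple. The central
  binomial coefficient is at least \<open>4 ^ n / (2 * n)\<close>, so \<open>n = 0\<close> is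
  treated apart.\<close>

lemma Lcm_ge_power4: "4 ^ n \<le> Lcm {1..Suc (2 * n)}"
proof (cases "n = 0")
  case False
  define L where "L = Lcm {1..Suc (2 * n)}"
  define c where "c = real (Suc (2 * n)) * real (2 * n choose n)"
  have c: "c > 0" by (auto simp: c_def simp del: of_nat_Suc)
  have "L > 0" by (auto simp: L_def intro!: Nat.gr0I)
  hence "real L / c > 0" using c by auto
  moreover have "real L / c \<in> \<int>" unfolding L_def c_def by (rule Lcm_triangle) auto
  ultimately have "real L / c \<ge> 1"
    by (metis Ints_cases of_int_0_less_iff of_int_1_le_iff zero_less_imp_eq_int int_one_le_iff_zero_less)
  hence "c \<le> real L" using c by (simp add: field_simps)
  have "4 ^ n = (4 ^ n / (2 * real n)) * (2 * real n)" using False by simp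
  also have "\<dots> \<le> real (2 * n choose n) * real (Suc (2 * n))"
    using central_binomial_lower_bound[of n] False by (intro mult_mono) auto
  also have "\<dots> = c" by (simp add: c_def)
  also note \<open>c \<le> real L\<close>
  finally have "real (4 ^ n) \<le> real L" by simp
  thus ?thesis unfolding of_nat_le_iff L_def .
qed auto

text \<open>The multiplicity of \<open>p\<close> in a least common multiple is the maximum of the
  multiplicities. A zero element is a separate case, since every prime power divides it.\<close>

lemma prime_power_dvd_Lcm:
  fixes p :: nat
  assumes "finite A" "prime p" "p ^ e dvd Lcm A" "A \<noteq> {}"
  shows "\<exists>a\<in>A. p ^ e dvd a"
  using assms(1,4,3)
proof (induction A rule: finite_ne_induct)
  case (insert a A)
  show ?case
  proof (cases "p ^ e dvd a \<or> p ^ e dvd Lcm A \<or> a = 0 \<or> Lcm A = 0")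
    case False
    hence "multiplicity p a < e" "multiplicity p (Lcm A) < e"
      using assms(2) by (metis multiplicity_dvd' not_le)+
    moreover have "multiplicity p (lcm a (Lcm A)) = max (multiplicity p a) (multiplicity p (Lcm A))"
      using False assms(2) by (intro multiplicity_lcm) auto
    moreover have "e \<le> multiplicity p (lcm a (Lcm A))"
      using insert.prems False assms(2) by (intro multiplicity_geI) (auto simp: lcm_eq_0_iff)
    ultimately show ?thesis by simp
  next
    case True
    moreover have "\<exists>a\<in>A. a = 0" if "Lcm A = 0" using that insert.hyps by (simp add: Lcm_0_iff)
    ultimately show ?thesis using insert.IH by auto
  qed
qed simp

text \<open>Each maximal prime power dividing the least common multiple already divides some number
  up to \<open>N\<close>, so it is at most \<open>N\<close>, and only primes up to \<open>N\<close>
  occur.\<close>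

lemma Lcm_le_prime_power: "Lcm {1..N::nat} \<le> N ^ card {p. prime p \<and> p \<le> N}"
proof (cases "N = 0")
  case False
  define L where "L = Lcm {1..N}"
  have L: "L \<noteq> 0" by (auto simp: L_def)
  have "L = (\<Prod>p\<in>prime_factors L. p ^ multiplicity p L)"
    using prime_factorization_nat[of L] L by simp
  also have "\<dots> \<le> (\<Prod>p\<in>prime_factors L. N)"
  proof (intro prod_mono conjI)
    fix p assume p: "p \<in> prime_factors L"
    have "p ^ multiplicity p L dvd Lcm {1..N}" unfolding L_def by (rule multiplicity_dvd)
    hence "\<exists>a\<in>{1..N}. p ^ multiplicity p L dvd a"
      using p False by (intro prime_power_dvd_Lcm) auto
    thus "p ^ multiplicity p L \<le> N" by (auto dest!: dvd_imp_le)
  qed auto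
  also have "\<dots> = N ^ card (prime_factors L)" by simp
  also have "\<dots> \<le> N ^ card {p. prime p \<and> p \<le> N}"
  proof (intro power_increasing card_mono)
    show "prime_factors L \<subseteq> {p. prime p \<and> p \<le> N}"
    proof safe
      fix p assume p: "p \<in> prime_factors L"
      hence "prime p" "p ^ 1 dvd Lcm {1..N}" unfolding L_def by auto
      hence "\<exists>a\<in>{1..N}. p ^ 1 dvd a"
        using False by (intro prime_power_dvd_Lcm) auto
      thus "p \<le> N" by (auto dest!: dvd_imp_le)
    qed auto
  qed (use False in auto)
  finally show ?thesis by (simp add: L_def)
next
  case True
  have e: "{p. prime p \<and> p \<le> N} = {}" using True by auto
  show ?thesis unfolding e using True by simp
qed

text \<open>The least common multiple of the numbers up to \<open>N\<close> lies between
  \<open>4 ^ n\<close> and \<open>N\<close> to the number of primes up to \<open>N\<close>; compare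
  logarithms.\<close>

lemma prime_count_lower_bound:
  assumes "2 \<le> y"
  shows "(y - 3) / 2 * ln 4 \<le> real (card {p::nat. prime p \<and> real p \<le> y}) * ln y"
proof -
  define N where "N = nat \<lfloor>y\<rfloor>"
  \<comment> \<open>The largest \<open>n\<close> with \<open>2 * n + 1 \<le> N\<close>. Rounding
    \<open>y\<close> down to \<open>N\<close> costs 1 and the parity of \<open>N\<close> at most 2
    more, which is the 3 in the bound.\<close>
  define n where "n = (N - 1) div 2"
  have N: "N \<ge> 2" using assms by (simp add: N_def le_nat_floor)
  have eq: "{p::nat. prime p \<and> real p \<le> y} = {p. prime p \<and> p \<le> N}"
    using assms by (auto simp: N_def le_nat_iff le_floor_iff)
  define c where "c = card {p::nat. prime p \<and> p \<le> N}"
  have "4 ^ n \<le> Lcm {1..Suc (2 * n)}" by (rule Lcm_ge_power4)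
  also have "\<dots> \<le> Lcm {1..N}"
  proof (rule dvd_imp_le)
    show "Lcm {1..Suc (2 * n)} dvd Lcm {1..N}" using N by (intro Lcm_subset) (auto simp: n_def)
  qed (auto intro!: Nat.gr0I)
  also have "\<dots> \<le> N ^ c" unfolding c_def by (rule Lcm_le_prime_power)
  finally have "4 ^ n \<le> N ^ c" .
  hence "(4::real) ^ n \<le> real N ^ c" by (metis of_nat_le_iff of_nat_numeral of_nat_power)
  hence "ln ((4::real) ^ n) \<le> ln (real N ^ c)" using N by simp
  hence "real n * ln 4 \<le> real c * ln (real N)" using N by (simp add: ln_realpow)
  also have "\<dots> \<le> real c * ln y"
    using N assms by (intro mult_left_mono) (auto simp: N_def)
  finally have "real n * ln 4 \<le> real c * ln y" .
  moreover have "(y - 3) / 2 \<le> real n"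
  proof -
    have "y - 1 \<le> real N" unfolding N_def using assms by linarith
    moreover have "N \<le> 2 * n + 2" unfolding n_def by linarith
    hence "real N \<le> 2 * real n + 2" by linarith
    ultimately show ?thesis by simp
  qed
  hence "(y - 3) / 2 * ln 4 \<le> real n * ln 4" by (intro mult_right_mono) auto
  ultimately show ?thesis unfolding eq c_def[symmetric] by linarith
qed

section \<open>Lower bound: products of distinct primes\<close>

lemma prime_dvd_prod_primes:
  fixes A :: "nat set"
  assumes "finite A" "\<And>q. q \<in> A \<Longrightarrow> prime q" "prime p"
  shows "p dvd \<Prod>A \<longleftrightarrow> p \<in> A"
proof -
  have "p dvd \<Prod>A \<longleftrightarrow> (\<exists>a\<in>A. p dvd a)"
    using prime_dvd_prod_iff[OF assms(1,3), of "\<lambda>x. x"] by simp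
  also have "\<dots> \<longleftrightarrow> (\<exists>a\<in>A. p = a)"
    using primes_dvd_imp_eq[OF assms(3) assms(2)] by (intro bex_cong refl) auto
  finally show ?thesis by simp
qed

text \<open>Products of \<open>k\<close> distinct primes up to \<open>y\<close> are smooth and at
  most \<open>y ^ k\<close>. Different sets of primes give different products, as a set is recovered
  from the prime divisors of its product.\<close>

lemma smooth_count_ge_binomial:
  fixes y :: real
  defines "\<P> \<equiv> {p::nat. prime p \<and> real p \<le> y}"
  assumes "y \<ge> 1" "y ^ k \<le> x"
  shows "card \<P> choose k \<le> smooth_count x y"
proof -
  have fin: "finite \<P>"
    by (rule finite_subset[of _ "{..nat \<lfloor>y\<rfloor>}"]) (auto simp: \<P>_def le_nat_floor)
  define F where "F = {A. A \<subseteq> \<P> \<and> card A = k}"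
  have dvd_iff: "p dvd \<Prod>A \<longleftrightarrow> p \<in> A" if "A \<in> F" "prime p" for A p
    using that fin by (intro prime_dvd_prod_primes) (auto simp: F_def \<P>_def intro: finite_subset)
  have "card \<P> choose k = card F" using n_subsets[OF fin, of k] by (simp add: F_def)
  also have "\<dots> = card ((\<lambda>A. \<Prod>A) ` F)"
  proof (rule card_image[symmetric], rule inj_onI)
    fix A B assume AB: "A \<in> F" "B \<in> F" "\<Prod>A = \<Prod>B"
    have "p \<in> A \<longleftrightarrow> p \<in> B" if "prime p" for p using dvd_iff AB that by metis
    thus "A = B" using AB by (auto simp: F_def \<P>_def)
  qed
  also have "\<dots> \<le> smooth_count x y"
    unfolding smooth_count_def
  proof (intro card_mono finite_smooth_numbers image_subsetI)
    fix A assume A: "A \<in> F"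
    have "real (\<Prod>A) = (\<Prod>p\<in>A. real p)" by simp
    also have "\<dots> \<le> (\<Prod>p\<in>A. y)" using A by (intro prod_mono) (auto simp: F_def \<P>_def)
    also have "\<dots> \<le> x" using A assms by (simp add: F_def)
    finally have "real (\<Prod>A) \<le> x" .
    moreover have "\<Prod>A \<ge> 1" using A by (intro prod_ge_1) (auto simp: F_def \<P>_def Suc_le_eq prime_gt_0_nat)
    moreover have "real p \<le> y" if "prime p" "p dvd \<Prod>A" for p
      using dvd_iff[OF A that(1)] that A by (auto simp: F_def \<P>_def)
    ultimately show "\<Prod>A \<in> smooth_numbers x y" unfolding smooth_numbers_def by blast
  qed
  finally show ?thesis .
qed

lemma sum_inverse_le_ln: "k \<ge> 1 \<Longrightarrow> (\<Sum>j=2..k. 1 / real j) \<le> ln (real k)"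
proof (induction k rule: nat_induct_at_least)
  case (Suc k)
  have "(\<Sum>j=2..Suc k. 1 / real j) = (\<Sum>j=2..k. 1 / real j) + 1 / real (Suc k)"
    using Suc by simp
  moreover have "ln (1 - 1 / real (Suc k)) \<le> - (1 / real (Suc k))"
    using ln_le_minus_one[of "1 - 1 / real (Suc k)"] Suc by simp
  moreover have "ln (1 - 1 / real (Suc k)) = ln (real k) - ln (real (Suc k))"
  proof -
    have "1 - 1 / real (Suc k) = real k / real (Suc k)" by (simp add: field_simps)
    thus ?thesis using Suc by (simp only: ln_div) (simp add: ln_div)
  qed
  ultimately show ?case using Suc by linarith
qed simp

text \<open>Each Euler factor is at most \<open>exp (4 * j powr (-s))\<close>, and
  \<open>j powr (-s) \<le> y powr (1 - s) / j\<close> reduces the exponent to a harmonic sum. The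
  condition \<open>s \<ge> 1 / 2\<close> keeps \<open>j powr (-s)\<close> below 3/4.\<close>

lemma rankin_bound:
  assumes s: "1 / 2 \<le> s" "s \<le> 1" and z: "z > 0" and y: "y \<ge> 1"
  shows "real (smooth_count z y) \<le> z powr s * exp (4 * (y powr (1 - s) * ln y))"
proof -
  define k where "k = nat \<lfloor>y\<rfloor>"
  have k: "k \<ge> 1" "real k \<le> y" using y by (auto simp: k_def le_nat_floor)
  have "(real p \<le> y) = (real p \<le> real k)" for p
  proof -
    have "(real p \<le> y) = (int p \<le> \<lfloor>y\<rfloor>)" by (simp add: le_floor_iff)
    also have "\<dots> = (p \<le> k)" using y by (simp add: k_def le_nat_iff)
    finally show ?thesis by simp
  qed
  hence "smooth_numbers z y = smooth_numbers z (real k)"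
    unfolding smooth_numbers_def by simp
  hence "real (smooth_count z y) \<le> z powr s * (\<Prod>j=2..k. 1 / (1 - real j powr (-s)))"
    using smooth_count_le_prod[of s z k] s z by (simp add: smooth_count_def)
  also have "(\<Prod>j=2..k. 1 / (1 - real j powr (-s))) \<le> (\<Prod>j=2..k. exp (4 * real j powr (-s)))"
  proof (intro prod_mono conjI)
    fix j assume j: "j \<in> {2..k}"
    define t where "t = real j powr (-s)"
    have "t \<le> real j powr (- (1/2))" unfolding t_def using j s by (intro powr_mono) auto
    also have "\<dots> \<le> 2 powr (- (1/2))" using j by (intro powr_mono2') auto
    also have "\<dots> \<le> 3 / 4"
    proof -
      have "4 / 3 \<le> sqrt 2" by (rule real_le_rsqrt) (simp add: power2_eq_square)
      thus ?thesis by (simp add: powr_minus powr_half_sqrt field_simps)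
    qed
    finally have t: "t \<le> 3 / 4" "t \<ge> 0" by (auto simp: t_def)
    \<comment> \<open>Equivalent to \<open>t * (3 - 4 * t) \<ge> 0\<close>, hence the need for
      \<open>t \<le> 3 / 4\<close>.\<close>
    have "1 / (1 - t) \<le> 1 + 4 * t"
      using t mult_nonneg_nonneg[of t "3 - 4 * t"] by (simp add: field_simps)
    also have "\<dots> \<le> exp (4 * t)" by (rule exp_ge_add_one_self)
    finally show "1 / (1 - real j powr (-s)) \<le> exp (4 * real j powr (-s))" by (simp add: t_def)
    show "0 \<le> 1 / (1 - real j powr (-s))" using t by (simp add: t_def)
  qed
  also have "\<dots> = exp (4 * (\<Sum>j=2..k. real j powr (-s)))"
    by (simp add: exp_sum sum_distrib_left)
  also have "\<dots> \<le> exp (4 * (y powr (1 - s) * ln y))"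
  proof -
    have "(\<Sum>j=2..k. real j powr (-s)) \<le> (\<Sum>j=2..k. y powr (1 - s) * (1 / real j))"
    proof (intro sum_mono)
      fix j assume j: "j \<in> {2..k}"
      have "real j powr (-s) = real j powr (1 - s) * (1 / real j)"
        using j by (simp add: powr_diff powr_minus field_simps)
      also have "\<dots> \<le> y powr (1 - s) * (1 / real j)"
        using j k s by (intro mult_right_mono powr_mono2) auto
      finally show "real j powr (-s) \<le> y powr (1 - s) * (1 / real j)" .
    qed
    also have "\<dots> = y powr (1 - s) * (\<Sum>j=2..k. 1 / real j)" by (simp add: sum_distrib_left)
    also have "\<dots> \<le> y powr (1 - s) * ln y"
    proof (intro mult_left_mono)
      have "ln (real k) \<le> ln y" using k by (intro ln_mono) auto
      thus "(\<Sum>j=2..k. 1 / real j) \<le> ln y" using sum_inverse_le_ln[OF k(1)] by linarith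
    qed auto
    finally show ?thesis by simp
  qed
  finally show ?thesis by (simp add: mult_left_mono)
qed

section \<open>Bilinear exponential sums\<close>

lemma add_char_add: "add_char (s + t) = add_char s * add_char t"
  by (simp add: add_char_def exp_add[symmetric] algebra_simps)

lemma norm_add_char [simp]: "norm (add_char s) = 1"
  by (simp add: add_char_def)

lemma cnj_add_char: "cnj (add_char s) = add_char (- s)"
  by (simp add: add_char_def exp_cnj)

lemma add_char_mult_nat: "add_char (t * real m) = add_char t ^ m"
  by (simp add: add_char_def exp_of_nat_mult[symmetric] mult_ac)

lemma jordan_sin:
  assumes "0 \<le> f" "f \<le> 1 / 2"
  shows "2 * f \<le> sin (pi * f)"
proof -
  have "convex_on {0..pi / 2} (\<lambda>x. - sin x)"
    by (rule f''_ge0_imp_convex[where f' = "\<lambda>x. - cos x" and f'' = sin])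
       (auto intro!: derivative_eq_intros sin_ge_zero)
  from convex_onD[OF this, of "2 * f" 0 "pi / 2"] assms show ?thesis
    by (simp add: mult_ac)
qed

text \<open>\<open>min (frac t) (1 - frac t)\<close> is the distance from \<open>t\<close> to the
  nearest integer. The left side of the chord identity is
  \<open>2 * \<bar>sin (pi * t)\<bar>\<close>, and Jordan's inequality bounds the sine from
  below.\<close>

lemma norm_add_char_minus_1_ge: "4 * min (frac t) (1 - frac t) \<le> norm (add_char t - 1)"
proof -
  have "add_char t = exp (\<i> * of_real (2 * pi * t))" by (simp add: add_char_def mult_ac)
  hence eq: "norm (add_char t - 1) = 2 * \<bar>sin (pi * t)\<bar>" by (simp only: dist_exp_i_1) simp
  have "\<bar>sin (pi * t)\<bar> = \<bar>sin (pi * frac t)\<bar>"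
  proof -
    have "pi * t = pi * frac t + pi * of_int \<lfloor>t\<rfloor>" by (simp add: frac_def algebra_simps)
    hence "sin (pi * t) = sin (pi * frac t) * cos (pi * of_int \<lfloor>t\<rfloor>)"
      by (simp only: sin_add sin_npi_int)
    moreover have "\<bar>cos (pi * of_int \<lfloor>t\<rfloor>)\<bar> = 1"
      by (simp add: cos_npi_int)
    ultimately show ?thesis by (simp add: abs_mult)
  qed
  also have "2 * min (frac t) (1 - frac t) \<le> \<bar>sin (pi * frac t)\<bar>"
  proof (cases "frac t \<le> 1 / 2")
    case True
    thus ?thesis using jordan_sin[of "frac t"] by (simp add: min_def)
  next
    case False
    have "sin (pi * (1 - frac t)) = sin (pi * frac t)"
      by (simp add: right_diff_distrib sin_diff)
    thus ?thesis using jordan_sin[of "1 - frac t"] False frac_lt_1[of t] by (simp add: min_def)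
  qed
  finally show ?thesis using eq by simp
qed

lemma norm_sum_add_char_le:
  assumes "frac t > 0"
  shows "norm (\<Sum>m=a..b. add_char (t * real m)) \<le> 1 / (2 * min (frac t) (1 - frac t))"
proof (cases "a \<le> b")
  case True
  define z where "z = add_char t"
  define \<mu> where "\<mu> = min (frac t) (1 - frac t)"
  have \<mu>: "\<mu> > 0" using assms frac_lt_1[of t] by (auto simp: \<mu>_def min_def)
  have "norm (1 - z) * norm (\<Sum>m=a..b. z ^ m) = norm (z ^ a - z ^ Suc b)"
    unfolding norm_mult[symmetric] sum_gp_multiplied[OF True] ..
  also have "\<dots> \<le> norm (z ^ a) + norm (z ^ Suc b)" by (rule norm_triangle_ineq4)
  also have "\<dots> = 2" unfolding norm_power by (simp add: z_def)
  finally have "norm (1 - z) * norm (\<Sum>m=a..b. z ^ m) \<le> 2" .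
  moreover have "4 * \<mu> \<le> norm (1 - z)"
    using norm_add_char_minus_1_ge[of t] by (simp add: z_def \<mu>_def norm_minus_commute)
  hence "4 * \<mu> * norm (\<Sum>m=a..b. z ^ m) \<le> norm (1 - z) * norm (\<Sum>m=a..b. z ^ m)"
    by (intro mult_right_mono) auto
  ultimately have "4 * \<mu> * norm (\<Sum>m=a..b. z ^ m) \<le> 2" by linarith
  hence "norm (\<Sum>m=a..b. z ^ m) \<le> 1 / (2 * \<mu>)" using \<mu> by (simp add: field_simps)
  thus ?thesis by (simp add: z_def \<mu>_def add_char_mult_nat)
next
  case False
  thus ?thesis using frac_lt_1[of t] by (simp add: less_imp_le)
qed

section \<open>Sums controlled by the distribution of fractional parts\<close>

definition frac_bin :: "nat \<Rightarrow> real \<Rightarrow> nat" where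
  "frac_bin M t = nat \<lfloor>real M * frac t\<rfloor>"

lemma frac_bin:
  assumes "M > 0"
  shows "frac_bin M t < M" "real (frac_bin M t) \<le> real M * frac t"
    "real M * frac t < real (frac_bin M t) + 1"
proof -
  have f: "0 \<le> real M * frac t" "real M * frac t < real M" using assms frac_lt_1[of t] by auto
  show "real (frac_bin M t) \<le> real M * frac t" "real M * frac t < real (frac_bin M t) + 1"
    unfolding frac_bin_def using f by linarith+
  thus "frac_bin M t < M" using f by linarith
qed

text \<open>A point in bin \<open>j\<close> is at distance at least
  \<open>min j (M - 1 - j) / M\<close> from the integers. The two end bins use the trivial bound
  \<open>R\<close>; the others give a harmonic sum, whence the logarithm.\<close>

lemma sum_le_binned:
  fixes u F :: "nat \<Rightarrow> real" and M G :: nat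
  assumes C: "finite C" and M: "M > 0" and R: "R \<ge> 0"
    and G: "\<And>j. j < M \<Longrightarrow> card {l\<in>C. frac_bin M (u l) = j} \<le> G"
    and F1: "\<And>l. l \<in> C \<Longrightarrow> F l \<le> R"
    and F2: "\<And>l. l \<in> C \<Longrightarrow> frac (u l) > 0 \<Longrightarrow> F l \<le> 1 / (2 * min (frac (u l)) (1 - frac (u l)))"
  shows "sum F C \<le> real G * (2 * R + real M * (1 + ln (real M)))"
proof -
  \<comment> \<open>\<open>h i\<close> bounds the term at a point separated from an integer by
    \<open>i\<close> full bins. \<open>b\<close> adds the contributions of both ends, which avoids
    asking which end is closer.\<close>
  define h where "h = (\<lambda>i. if i = 0 then R else real M / (2 * real i))"
  have h0: "h i \<ge> 0" for i using R by (auto simp: h_def)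
  define b where "b = (\<lambda>j. h j + h (M - Suc j))"
  have Fb: "F l \<le> b (frac_bin M (u l))" if l: "l \<in> C" for l
  proof -
    define j where "j = frac_bin M (u l)"
    define f where "f = frac (u l)"
    have j: "j < M" "real j \<le> real M * f" "real M * f < real j + 1"
      using frac_bin[OF M, of "u l"] by (auto simp: j_def f_def)
    show ?thesis
    proof (cases "j = 0 \<or> M - Suc j = 0")
      case True
      hence "R \<le> b j" unfolding b_def using h0[of j] h0[of "M - Suc j"] by (auto simp: h_def)
      thus ?thesis using F1[OF l] by (simp add: j_def)
    next
      case False
      define i where "i = real (M - Suc j)"
      have i: "i > 0" "i = real M - real j - 1" using False j by (auto simp: i_def)
      have hj: "h j = real M / (2 * real j)" "h (M - Suc j) = real M / (2 * i)"
        using False by (auto simp: h_def i_def)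
      have j0: "real j > 0" using False by simp
      have fpos: "f > 0" using j j0 M by (metis less_le_trans mult_zero_right of_nat_0_less_iff zero_less_mult_pos)
      have "1 / (2 * f) \<le> h j"
        unfolding hj using j j0 fpos M by (simp add: field_simps)
      moreover have "1 / (2 * (1 - f)) \<le> h (M - Suc j)"
      proof -
        have "i \<le> real M * (1 - f)" using i j by (simp add: algebra_simps)
        moreover have "1 - f > 0" using frac_lt_1[of "u l"] by (simp add: f_def)
        ultimately show ?thesis unfolding hj using i M by (simp add: field_simps)
      qed
      moreover have "F l \<le> 1 / (2 * min f (1 - f))"
        using F2[OF l] fpos by (simp add: f_def)
      moreover have "1 / (2 * min f (1 - f)) \<le> max (1 / (2 * f)) (1 / (2 * (1 - f)))"
        by (simp add: min_def)
      ultimately show ?thesis using h0[of j] h0[of "M - Suc j"]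
        by (simp add: b_def j_def[symmetric] max_def split: if_splits)
    qed
  qed
  have "sum h {..<M} \<le> R + real M / 2 * (1 + ln (real M))"
  proof -
    have "{..<M} = insert 0 {1..M - 1}" using M by auto
    hence "sum h {..<M} = R + (\<Sum>i=1..M - 1. real M / (2 * real i))"
      by (simp add: h_def)
    also have "(\<Sum>i=1..M - 1. real M / (2 * real i)) \<le> (\<Sum>i=1..M. real M / (2 * real i))"
      by (intro sum_mono2) auto
    also have "\<dots> = real M / 2 * (\<Sum>i=1..M. 1 / real i)" by (simp add: sum_distrib_left)
    also have "(\<Sum>i=1..M. 1 / real i) = 1 + (\<Sum>i=2..M. 1 / real i)"
      using M by (subst sum.atLeast_Suc_atMost) (auto simp: numeral_2_eq_2)
    also have "real M / 2 * \<dots> \<le> real M / 2 * (1 + ln (real M))"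
      using sum_inverse_le_ln[of M] M by (intro mult_left_mono) auto
    finally show ?thesis by simp
  qed
  moreover have "sum b {..<M} = 2 * sum h {..<M}"
    unfolding b_def sum.distrib sum.nat_diff_reindex by simp
  ultimately have sb: "sum b {..<M} \<le> 2 * R + real M * (1 + ln (real M))"
    by (simp add: field_simps)
  have "sum F C \<le> (\<Sum>l\<in>C. b (frac_bin M (u l)))" using Fb by (rule sum_mono)
  also have "\<dots> = (\<Sum>j<M. \<Sum>l\<in>{l\<in>C. frac_bin M (u l) = j}. b (frac_bin M (u l)))"
    using C frac_bin(1)[OF M] by (intro sum.group[symmetric]) auto
  also have "\<dots> = (\<Sum>j<M. real (card {l\<in>C. frac_bin M (u l) = j}) * b j)"
    by (intro sum.cong refl) simp
  also have "\<dots> \<le> (\<Sum>j<M. real G * b j)"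
    using G h0 by (intro sum_mono mult_right_mono) (auto simp: b_def)
  also have "\<dots> = real G * sum b {..<M}" by (simp add: sum_distrib_left)
  also have "\<dots> \<le> real G * (2 * R + real M * (1 + ln (real M)))"
    using sb by (intro mult_left_mono) auto
  finally show ?thesis .
qed

text \<open>After division by the common \<open>gcd l q\<close>, each \<open>l\<close> has a divisor \<open>k\<close> of size about \<open>W\<close> that is coprime to the
  remaining modulus, so the elements of \<open>D\<close> with the same \<open>k\<close> are spaced by multiples of \<open>q * k\<close>
  and there are at most three of them. Counting the \<open>k\<close> is what retains the sparsity of the smooth numbers.\<close>

lemma card_smooth_progression_le:
  fixes D :: "nat set" and q W :: nat
  assumes D: "D \<subseteq> smooth_numbers Z y" and q: "q > 0" and W: "W \<ge> 2" and y: "y \<ge> 1"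
    and diff: "\<And>l l'. l \<in> D \<Longrightarrow> l' \<in> D \<Longrightarrow> l' \<le> l \<Longrightarrow> q dvd l - l' \<and> l - l' \<le> 2 * q * W"
  shows "card D \<le> 3 * smooth_count (real W * y) y"
proof (cases "D = {}")
  case False
  have fin: "finite D" using D finite_subset by fastforce
  obtain l0 where l0: "l0 \<in> D" using False by auto
  define g where "g = gcd l0 q"
  have gcd: "gcd l q = g" if "l \<in> D" for l
  proof -
    \<comment> \<open>Numbers congruent modulo \<open>q\<close> have the same greatest common
      divisor with \<open>q\<close>.\<close>
    have gcd_eq: "gcd l q = gcd l' q" if *: "l \<in> D" "l' \<in> D" "l' \<le> l" for l l'
    proof -
      obtain c where "l - l' = q * c" using diff[OF *] by blast
      hence "l = l' + c * q" using * by (simp add: mult_ac)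
      thus ?thesis by (metis gcd.commute gcd_add_mult add.commute)
    qed
    show ?thesis unfolding g_def using gcd_eq[OF that l0] gcd_eq[OF l0 that] by (metis nle_le)
  qed
  have g: "g > 0" "g dvd q" using q by (auto simp: g_def)
  have gl: "g dvd l" if "l \<in> D" for l using gcd[OF that] by (metis gcd_dvd1)
  define q' where "q' = q div g"
  have qq: "q = g * q'" using g by (simp add: q'_def)
  have "\<exists>k. k dvd l div g \<and> k \<in> smooth_numbers (real W * y) y \<and> (k \<ge> W \<or> k = l div g)"
    if l: "l \<in> D" for l
  proof -
    have "l div g \<in> smooth_numbers Z y"
    proof (rule smooth_numbers_dvd)
      show "l \<in> smooth_numbers Z y" using D l by auto
      thus "real (l div g) \<le> Z"
        by (auto simp: smooth_numbers_def intro: order.trans[of _ "real l"] div_le_dividend)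
      show "l div g dvd l" using gl[OF l] by (metis dvd_div_mult_self dvd_triv_left)
    qed
    thus ?thesis using smooth_divisor_exists[OF W _ y] by metis
  qed
  then obtain \<kappa> where \<kappa>: "\<And>l. l \<in> D \<Longrightarrow> \<kappa> l dvd l div g"
      "\<And>l. l \<in> D \<Longrightarrow> \<kappa> l \<in> smooth_numbers (real W * y) y"
      "\<And>l. l \<in> D \<Longrightarrow> \<kappa> l \<ge> W \<or> \<kappa> l = l div g"
    by metis
  have fibre: "card {l\<in>D. \<kappa> l = k} \<le> 3" for k
  proof (cases "{l\<in>D. \<kappa> l = k} = {}")
    case nonempty: False
    define E where "E = {l\<in>D. \<kappa> l = k}"
    define m where "m = Min E"
    have E: "finite E" "E \<noteq> {}" using fin nonempty by (auto simp: E_def)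
    have mE: "m \<in> E" unfolding m_def using E by (rule Min_in)
    have k0: "k > 0" using mE \<kappa>(2)[of m] by (auto simp: E_def smooth_numbers_def)
    have "E \<subseteq> (\<lambda>i. m + i * (q * k)) ` {0,1,2}"
    proof
      fix l assume l: "l \<in> E"
      have ml: "m \<le> l" unfolding m_def using E l by auto
      have lD: "l \<in> D" "m \<in> D" "\<kappa> l = k" "\<kappa> m = k" using l mE by (auto simp: E_def)
      have d: "q dvd l - m" "l - m \<le> 2 * q * W" using diff[OF lD(1,2) ml] by auto
      obtain c where c: "l - m = q * c" using d(1) by (elim dvdE)
      \<comment> \<open>\<open>k\<close> divides both \<open>l div g\<close> and
        \<open>m div g\<close>, hence their difference \<open>q' * c\<close>; being coprime to
        \<open>q'\<close> it divides \<open>c\<close>.\<close>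
      have "k dvd c"
      proof -
        have "l - m = g * (l div g - m div g)"
          using gl[OF lD(1)] gl[OF lD(2)] by (simp add: diff_mult_distrib2)
        hence "q' * c = l div g - m div g" using c g(1) by (simp add: qq mult.assoc)
        moreover have "k dvd l div g - m div g"
          using \<kappa>(1)[OF lD(1)] \<kappa>(1)[OF lD(2)] lD by (intro dvd_diff_nat) auto
        ultimately have "k dvd q' * c" by simp
        moreover have "coprime k q'"
        proof -
          have "coprime (l div g) q'"
            unfolding q'_def gcd[OF lD(1), symmetric] using q by (intro div_gcd_coprime) auto
          thus ?thesis using \<kappa>(1)[OF lD(1)] lD coprime_divisors[of k "l div g" q' q'] by auto
        qed
        ultimately show ?thesis by (simp add: coprime_dvd_mult_right_iff)
      qed
      then obtain i where i: "c = k * i" by (elim dvdE)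
      have "l = m + (l - m)" using ml by simp
      also have "l - m = i * (q * k)" using c i by (simp add: mult_ac)
      finally have li: "l = m + i * (q * k)" .
      have "i \<le> 2"
      proof (cases "k \<ge> W")
        case True
        have "i * (q * k) \<le> 2 * q * W" using d(2) li by simp
        also have "\<dots> \<le> 2 * (q * k)" using True by simp
        finally show ?thesis using q k0 by simp
      next
        case False
        \<comment> \<open>A divisor below \<open>W\<close> must be the whole quotient, so
          \<open>l\<close> and \<open>m\<close> share their quotient by \<open>g\<close> and
          coincide.\<close>
        hence "l div g = m div g" using \<kappa>(3)[OF lD(1)] \<kappa>(3)[OF lD(2)] lD by auto
        hence "l = m" using gl[OF lD(1)] gl[OF lD(2)] by (metis dvd_mult_div_cancel)
        thus ?thesis using li q k0 by simp
      qed
      hence "i \<in> {0,1,2}" by auto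
      thus "l \<in> (\<lambda>i. m + i * (q * k)) ` {0,1,2}" using li by blast
    qed
    hence "card E \<le> card ((\<lambda>i. m + i * (q * k)) ` {0,1,2::nat})" by (intro card_mono) auto
    also have "\<dots> \<le> card {0,1,2::nat}" by (rule card_image_le) simp
    finally show ?thesis by (simp add: E_def)
  next
    case True
    show ?thesis unfolding True by simp
  qed
  have "card D = (\<Sum>l\<in>D. 1)" by simp
  also have "\<dots> = (\<Sum>k\<in>\<kappa> ` D. \<Sum>l\<in>{l\<in>D. \<kappa> l = k}. 1)" by (rule sum.image_gen[OF fin])
  also have "\<dots> \<le> (\<Sum>k\<in>\<kappa> ` D. 3)" using fibre by (intro sum_mono) simp
  also have "\<dots> = 3 * card (\<kappa> ` D)" by simp
  also have "card (\<kappa> ` D) \<le> smooth_count (real W * y) y"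
    unfolding smooth_count_def using \<kappa>(2) by (intro card_mono) auto
  finally show ?thesis by simp
qed auto

text \<open>Cauchy-Schwarz in \<open>m\<close>, after which positivity allows extending
  \<open>B\<close> to the full interval \<open>{M..R}\<close>. Expanding the square and exchanging
  sums, the conditions \<open>m * l \<le> x\<close> and \<open>m * l' \<le> x\<close> merge into one
  upper limit on \<open>m\<close>, so the inner sums are geometric.\<close>

lemma norm_bilinear_sum_le:
  fixes x \<theta> :: real
  assumes B: "B \<subseteq> {M..R}" and C: "finite C" "\<And>l. l \<in> C \<Longrightarrow> l > 0" and M: "M > 0" and x: "x \<ge> 0"
  shows "(norm (\<Sum>m\<in>B. \<Sum>l | l \<in> C \<and> real (m * l) \<le> x. add_char (\<theta> * real (m * l))))\<^sup>2
    \<le> real (card B) * (\<Sum>l\<in>C. \<Sum>l'\<in>C.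
        norm (\<Sum>m=M..min R (nat \<lfloor>x / max (real l) (real l')\<rfloor>). add_char (\<theta> * (real l - real l') * real m)))"
proof -
  have fB: "finite B" using B finite_subset by blast
  define A where "A = (\<lambda>m. \<Sum>l | l \<in> C \<and> real (m * l) \<le> x. add_char (\<theta> * real (m * l)))"
  define P where "P = (\<lambda>l l'. min R (nat \<lfloor>x / max (real l) (real l')\<rfloor>))"
  have P: "m \<in> {M..P l l'} \<longleftrightarrow> m \<in> {M..R} \<and> real (m * l) \<le> x \<and> real (m * l') \<le> x"
    if "l \<in> C" "l' \<in> C" for m l l'
  proof -
    define L where "L = max (real l) (real l')"
    have L: "L > 0" using C(2) that by (auto simp: L_def max_def)
    have "m \<le> nat \<lfloor>x / L\<rfloor> \<longleftrightarrow> real m \<le> x / L"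
      using x L by (simp add: le_nat_iff le_floor_iff)
    also have "\<dots> \<longleftrightarrow> real m * L \<le> x" using L by (simp add: field_simps)
    also have "real m * L = max (real (m * l)) (real (m * l'))"
      unfolding L_def by (simp add: max_mult_distrib_left)
    finally show ?thesis by (auto simp: P_def L_def)
  qed
  have "(norm (\<Sum>m\<in>B. A m))\<^sup>2 \<le> (\<Sum>m\<in>B. 1 * norm (A m))\<^sup>2"
    using norm_sum[of A B] by (intro power_mono) auto
  also have "\<dots> \<le> (\<Sum>m\<in>B. 1\<^sup>2) * (\<Sum>m\<in>B. (norm (A m))\<^sup>2)" by (rule Cauchy_Schwarz_ineq_sum)
  also have "\<dots> = real (card B) * (\<Sum>m\<in>B. (norm (A m))\<^sup>2)" by simp
  also have "(\<Sum>m\<in>B. (norm (A m))\<^sup>2) \<le> (\<Sum>m=M..R. (norm (A m))\<^sup>2)"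
    using B by (intro sum_mono2) auto
  \<comment> \<open>The nonnegative real sum is written as the norm of a complex one, so that the
    product with the conjugate can be expanded.\<close>
  also have "(\<Sum>m=M..R. (norm (A m))\<^sup>2) = norm (\<Sum>m=M..R. A m * cnj (A m))"
  proof -
    have "(\<Sum>m=M..R. A m * cnj (A m)) = of_real (\<Sum>m=M..R. (norm (A m))\<^sup>2)"
      unfolding of_real_sum complex_norm_square ..
    thus ?thesis by (simp only: norm_of_real) (simp add: sum_nonneg)
  qed
  also have "(\<Sum>m=M..R. A m * cnj (A m)) =
      (\<Sum>m=M..R. \<Sum>l\<in>C. \<Sum>l'\<in>C. if m \<in> {M..P l l'} then add_char (\<theta> * (real l - real l') * real m) else 0)"
  proof (intro sum.cong refl)
    fix m assume m: "m \<in> {M..R}"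
    have "A m = (\<Sum>l\<in>C. if real (m * l) \<le> x then add_char (\<theta> * real (m * l)) else 0)"
      unfolding A_def by (rule sum.inter_filter[OF C(1)])
    hence "A m * cnj (A m) = (\<Sum>l\<in>C. \<Sum>l'\<in>C. (if real (m * l) \<le> x then add_char (\<theta> * real (m * l)) else 0) *
        cnj (if real (m * l') \<le> x then add_char (\<theta> * real (m * l')) else 0))"
      by (simp only: cnj_sum sum_product)
    also have "\<dots> = (\<Sum>l\<in>C. \<Sum>l'\<in>C. if m \<in> {M..P l l'} then add_char (\<theta> * (real l - real l') * real m) else 0)"
    proof (intro sum.cong refl)
      fix l l' assume l: "l \<in> C" "l' \<in> C"
      have "add_char (\<theta> * real (m * l)) * cnj (add_char (\<theta> * real (m * l'))) =
            add_char (\<theta> * (real l - real l') * real m)"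
        unfolding cnj_add_char add_char_add[symmetric] by (simp add: algebra_simps)
      thus "(if real (m * l) \<le> x then add_char (\<theta> * real (m * l)) else 0) *
          cnj (if real (m * l') \<le> x then add_char (\<theta> * real (m * l')) else 0) =
          (if m \<in> {M..P l l'} then add_char (\<theta> * (real l - real l') * real m) else 0)"
        unfolding P[OF l] using m by auto
    qed
    finally show "A m * cnj (A m) = \<dots>" .
  qed
  also have "\<dots> = (\<Sum>l\<in>C. \<Sum>l'\<in>C. \<Sum>m=M..R. if m \<in> {M..P l l'} then add_char (\<theta> * (real l - real l') * real m) else 0)"
    by (subst sum.swap) (rule sum.cong[OF refl], rule sum.swap)
  also have "\<dots> = (\<Sum>l\<in>C. \<Sum>l'\<in>C. \<Sum>m=M..P l l'. add_char (\<theta> * (real l - real l') * real m))"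
  proof (rule sum.cong[OF refl], rule sum.cong[OF refl])
    fix l l'
    have e: "{M..R} \<inter> {M..P l l'} = {M..P l l'}" by (auto simp: P_def)
    show "(\<Sum>m=M..R. if m \<in> {M..P l l'} then add_char (\<theta> * (real l - real l') * real m) else 0) =
       (\<Sum>m=M..P l l'. add_char (\<theta> * (real l - real l') * real m))"
      using sum.inter_restrict[of "{M..R}" "\<lambda>m. add_char (\<theta> * (real l - real l') * real m)" "{M..P l l'}"]
      unfolding e by (simp only: finite_atLeastAtMost)
  qed
  also have "norm \<dots> \<le> (\<Sum>l\<in>C. \<Sum>l'\<in>C. norm (\<Sum>m=M..P l l'. add_char (\<theta> * (real l - real l') * real m)))"
    by (rule order.trans[OF norm_sum], rule sum_mono, rule norm_sum)
  finally show ?thesis unfolding A_def P_def by (simp add: mult_left_mono)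
qed

section \<open>Decomposition of the exponential sum\<close>

text \<open>The values of \<open>lead M n\<close> with greatest prime \<open>p\<close>. Fixing
  \<open>p\<close> makes the choice of \<open>m\<close> here independent of the cofactor in
  \<open>rough_part\<close>, apart from the condition \<open>m * l \<le> x\<close>.\<close>

definition lead_part :: "nat \<Rightarrow> real \<Rightarrow> real \<Rightarrow> nat \<Rightarrow> nat set" where
  "lead_part M x y p = {m \<in> smooth_numbers x y. M \<le> m \<and> m div gpf m < M \<and> gpf m = p}"

definition rough_part :: "nat \<Rightarrow> real \<Rightarrow> real \<Rightarrow> nat \<Rightarrow> nat set" where
  "rough_part M x y p = {l \<in> smooth_numbers (x / real M) y. \<forall>r. prime r \<longrightarrow> r dvd l \<longrightarrow> p \<le> r}"

text \<open>Both inclusions restate the bijection: \<open>lead_properties\<close> gives one and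
  \<open>lead_mult_eq\<close> the other. The cofactor is at most \<open>x / M\<close> because
  \<open>m\<close> is at least \<open>M\<close>.\<close>

lemma lead_fibre:
  assumes M: "M \<ge> 2" and m: "m \<in> smooth_numbers x y" "M \<le> m" "m div gpf m < M"
  shows "{n \<in> smooth_numbers x y. M \<le> n \<and> lead M n = m} =
    (\<lambda>l. m * l) ` {l \<in> rough_part M x y (gpf m). real (m * l) \<le> x}" (is "?A = ?B")
proof (intro equalityI subsetI)
  fix n assume n: "n \<in> ?A"
  hence n': "n \<in> smooth_numbers x y" "M \<le> n" "lead M n = m" by auto
  have p: "m dvd n" "\<And>r. prime r \<Longrightarrow> r dvd n div m \<Longrightarrow> gpf m \<le> r"
    using lead_properties[OF M n'(2)] n'(3) by auto
  define l where "l = n div m"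
  have nl: "n = m * l" using p(1) by (simp add: l_def)
  have nx: "real n \<le> x" using n'(1) by (simp add: smooth_numbers_def)
  have "real M * real l \<le> real m * real l" using m by (intro mult_right_mono) auto
  also have "\<dots> \<le> x" using nx by (simp add: nl)
  finally have "real l \<le> x / real M" using M by (simp add: field_simps)
  moreover have "l dvd n" by (simp add: nl)
  ultimately have "l \<in> rough_part M x y (gpf m)"
    using smooth_numbers_dvd[OF n'(1)] p(2) by (auto simp: rough_part_def l_def)
  thus "n \<in> ?B" using nx nl by auto
next
  fix n assume "n \<in> ?B"
  then obtain l where l: "n = m * l" "l \<in> rough_part M x y (gpf m)" "real (m * l) \<le> x" by auto
  have l0: "l \<ge> 1" "\<And>r. prime r \<Longrightarrow> r dvd l \<Longrightarrow> gpf m \<le> r"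
     "\<And>r. prime r \<Longrightarrow> r dvd l \<Longrightarrow> real r \<le> y"
    using l(2) by (auto simp: rough_part_def smooth_numbers_def)
  have "lead M n = m" unfolding l(1) using l0 by (intro lead_mult_eq M m) auto
  moreover have "n \<in> smooth_numbers x y"
    using m(1) l l0 by (auto simp: smooth_numbers_def prime_dvd_mult_iff)
  moreover have "M \<le> n" using m(2) l0(1) unfolding l(1) by (metis le_trans mult.right_neutral mult_le_mono2)
  ultimately show "n \<in> ?A" by auto
qed

lemma lead_part_subset:
  assumes "M \<ge> 2"
  shows "lead_part M x y p \<subseteq> {M..nat \<lfloor>real M * y\<rfloor>}"
proof
  fix m assume m: "m \<in> lead_part M x y p"
  hence m1: "m > 1" using assms by (auto simp: lead_part_def)
  have "m = gpf m * (m div gpf m)" using gpf_dvd[OF m1] by simp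
  hence "real m = real (gpf m) * real (m div gpf m)" by (metis of_nat_mult)
  also have "\<dots> \<le> y * real M"
  proof (intro mult_mono)
    show "real (gpf m) \<le> y"
      using m prime_gpf[OF m1] gpf_dvd[OF m1] by (auto simp: lead_part_def smooth_numbers_def)
    thus "0 \<le> y" by linarith
  qed (use m in \<open>auto simp: lead_part_def\<close>)
  finally have "m \<le> nat \<lfloor>real M * y\<rfloor>" by (simp add: le_nat_floor mult_ac)
  thus "m \<in> {M..nat \<lfloor>real M * y\<rfloor>}" using m by (auto simp: lead_part_def)
qed

text \<open>The \<open>n\<close> below \<open>M\<close> are estimated trivially. The rest are
  grouped by \<open>m = lead M n\<close> and then by \<open>p = gpf m\<close>, which leaves one
  bilinear sum for each \<open>p\<close>.\<close>

lemma norm_smooth_exp_sum_le_bilinear: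
  assumes M: "M \<ge> 2"
  shows "norm (smooth_exp_sum \<theta> x y) \<le> real M + (\<Sum>p=1..nat \<lfloor>y\<rfloor>.
     norm (\<Sum>m\<in>lead_part M x y p. \<Sum>l | l \<in> rough_part M x y p \<and> real (m * l) \<le> x.
       add_char (\<theta> * real (m * l))))"
proof -
  define S where "S = smooth_numbers x y"
  define S1 where "S1 = {n\<in>S. n < M}"
  define S2 where "S2 = {n\<in>S. M \<le> n}"
  define BB where "BB = {m\<in>S. M \<le> m \<and> m div gpf m < M}"
  define f where "f = (\<lambda>n. add_char (\<theta> * real n))"
  have fin: "finite S" "finite S1" "finite S2" "finite BB"
    by (auto simp: S_def S1_def S2_def BB_def)
  have S: "S = S1 \<union> S2" "S1 \<inter> S2 = {}" by (auto simp: S1_def S2_def)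
  have "norm (sum f S1) \<le> (\<Sum>n\<in>S1. norm (f n))" by (rule norm_sum)
  also have "\<dots> = real (card S1)" by (simp add: f_def)
  also have "\<dots> \<le> real (card {..<M})" by (intro of_nat_mono card_mono) (auto simp: S1_def)
  finally have s1: "norm (sum f S1) \<le> real M" by simp
  have "sum f S2 = (\<Sum>m\<in>BB. sum f {n\<in>S2. lead M n = m})"
  proof (rule sum.group[symmetric, OF fin(3,4)])
    show "lead M ` S2 \<subseteq> BB"
    proof safe
      fix n assume n: "n \<in> S2"
      hence "M \<le> n" "n \<in> S" by (auto simp: S2_def)
      note l = lead_properties[OF M this(1)]
      have "lead M n \<le> n" using l \<open>M \<le> n\<close> M by (intro dvd_imp_le) auto
      moreover have "real n \<le> x" using \<open>n \<in> S\<close> by (auto simp: S_def smooth_numbers_def)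
      ultimately have "real (lead M n) \<le> x" by linarith
      thus "lead M n \<in> BB"
        using l \<open>n \<in> S\<close> smooth_numbers_dvd[of n x y "lead M n" x] by (auto simp: BB_def S_def)
    qed
  qed
  also have "\<dots> = (\<Sum>m\<in>BB. \<Sum>l | l \<in> rough_part M x y (gpf m) \<and> real (m * l) \<le> x. f (m * l))"
  proof (rule sum.cong[OF refl])
    fix m assume m: "m \<in> BB"
    hence m': "m \<in> smooth_numbers x y" "M \<le> m" "m div gpf m < M" by (auto simp: BB_def S_def)
    have "{n\<in>S2. lead M n = m} = {n \<in> smooth_numbers x y. M \<le> n \<and> lead M n = m}"
      by (auto simp: S2_def S_def)
    also have "\<dots> = (\<lambda>l. m * l) ` {l \<in> rough_part M x y (gpf m). real (m * l) \<le> x}"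
      by (rule lead_fibre[OF M m'])
    finally have e: "{n\<in>S2. lead M n = m} = \<dots>" .
    show "sum f {n\<in>S2. lead M n = m} =
        (\<Sum>l | l \<in> rough_part M x y (gpf m) \<and> real (m * l) \<le> x. f (m * l))"
      unfolding e using M m'(2) by (subst sum.reindex) (auto simp: inj_on_def)
  qed
  also have "\<dots> = (\<Sum>p=1..nat \<lfloor>y\<rfloor>. \<Sum>m | m \<in> BB \<and> gpf m = p.
      \<Sum>l | l \<in> rough_part M x y (gpf m) \<and> real (m * l) \<le> x. f (m * l))"
  proof (rule sum.group[symmetric, OF fin(4)])
    show "gpf ` BB \<subseteq> {1..nat \<lfloor>y\<rfloor>}"
    proof safe
      fix m assume m: "m \<in> BB"
      hence m1: "m > 1" using M by (auto simp: BB_def)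
      have "real (gpf m) \<le> y"
        using m prime_gpf[OF m1] gpf_dvd[OF m1] by (auto simp: BB_def S_def smooth_numbers_def)
      thus "gpf m \<in> {1..nat \<lfloor>y\<rfloor>}"
        using prime_gt_0_nat[OF prime_gpf[OF m1]] by (auto simp: le_nat_floor)
    qed
  qed auto
  also have "\<dots> = (\<Sum>p=1..nat \<lfloor>y\<rfloor>. \<Sum>m\<in>lead_part M x y p.
      \<Sum>l | l \<in> rough_part M x y p \<and> real (m * l) \<le> x. f (m * l))"
    by (intro sum.cong refl) (auto simp: lead_part_def BB_def S_def)
  finally have s2_eq: "sum f S2 = (\<Sum>p=1..nat \<lfloor>y\<rfloor>. \<Sum>m\<in>lead_part M x y p.
      \<Sum>l | l \<in> rough_part M x y p \<and> real (m * l) \<le> x. f (m * l))" .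
  have s2: "norm (sum f S2) \<le> (\<Sum>p=1..nat \<lfloor>y\<rfloor>. norm (\<Sum>m\<in>lead_part M x y p.
      \<Sum>l | l \<in> rough_part M x y p \<and> real (m * l) \<le> x. f (m * l)))"
    unfolding s2_eq by (rule norm_sum)
  have "smooth_exp_sum \<theta> x y = sum f S1 + sum f S2"
    unfolding smooth_exp_sum_def f_def[symmetric] S_def[symmetric]
    by (subst S(1)) (rule sum.union_disjoint[OF fin(2,3) S(2)])
  hence "norm (smooth_exp_sum \<theta> x y) \<le> norm (sum f S1) + norm (sum f S2)"
    by (simp add: norm_triangle_ineq)
  thus ?thesis using s1 s2 by (simp add: f_def)
qed

text \<open>If \<open>\<theta> * r\<close> is within \<open>1 / M\<close> of the integer
  \<open>k\<close>, then \<open>a * r / q\<close> is within \<open>L / M \<le> 1 / (4 * q)\<close>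
  of it, so the integer \<open>a * r - k * q\<close> vanishes and \<open>q\<close> divides
  \<open>r\<close>. What remains is \<open>\<bar>\<theta> - a / q\<bar> * r < 1 / M\<close>, which
  restricts \<open>r\<close> to the shorter range.\<close>

lemma near_integer_imp_dvd:
  fixes \<theta> x L :: real and a k :: int and q M r :: nat
  assumes q: "q > 0" "coprime a (int q)"
    and L: "L = 1 + \<bar>\<theta> - of_int a / real q\<bar> * x" and x: "x \<ge> 0"
    and M: "4 * real q * L \<le> real M"
    and k: "\<bar>\<theta> * real r - of_int k\<bar> < 1 / real M" and r: "real r \<le> x / real M"
  shows "q dvd r" "real r * L \<le> 2 * (x / real M)"
proof -
  define \<delta> where "\<delta> = \<theta> - of_int a / real q"
  have L1: "L \<ge> 1" using x unfolding L by simp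
  have "4 * 1 * 1 \<le> 4 * real q * L" using q L1 by (intro mult_mono) auto
  hence M0: "real M > 0" using M by linarith
  have dr: "\<bar>\<delta>\<bar> * real r \<le> \<bar>\<delta>\<bar> * (x / real M)" using r by (intro mult_left_mono) auto
  have th: "\<theta> * real r = of_int a * real r / real q + \<delta> * real r"
    by (simp add: \<delta>_def algebra_simps)
  have "\<bar>of_int a * real r / real q - of_int k\<bar> \<le> \<bar>\<theta> * real r - of_int k\<bar> + \<bar>\<delta>\<bar> * real r"
    unfolding th using abs_mult[of \<delta> "real r"] by simp
  also have "\<dots> < 1 / real M + \<bar>\<delta>\<bar> * (x / real M)" using k dr by linarith
  also have "\<dots> = L / real M" unfolding L \<delta>_def[symmetric] by (simp add: add_divide_distrib)
  also have "\<dots> \<le> 1 / (4 * real q)" using M M0 q by (simp add: field_simps)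
  finally have "\<bar>of_int a * real r / real q - of_int k\<bar> * real q < 1 / (4 * real q) * real q"
    using q by (intro mult_strict_right_mono) auto
  hence "\<bar>(of_int a * real r / real q - of_int k) * real q\<bar> < 1"
    using q by (simp add: abs_mult)
  also have "(of_int a * real r / real q - of_int k) * real q = of_int (a * int r - k * int q)"
    using q by (simp add: field_simps)
  finally have "a * int r = k * int q" by linarith
  hence "int q dvd a * int r" by simp
  hence "int q dvd int r" using q(2) by (simp add: coprime_commute coprime_dvd_mult_right_iff)
  thus "q dvd r" by simp
  have "of_int a * real r = of_int k * real q"
    using \<open>a * int r = k * int q\<close> by (metis of_int_mult of_int_of_nat_eq)
  hence "\<theta> * real r - of_int k = \<delta> * real r" unfolding th using q by (simp add: field_simps)
  hence "\<bar>\<delta>\<bar> * real r < 1 / real M" using k by (simp add: abs_mult)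
  hence "\<bar>\<delta>\<bar> * real r * x \<le> 1 / real M * x" using x by (intro mult_right_mono) auto
  moreover have "real r * L = real r + \<bar>\<delta>\<bar> * real r * x"
    unfolding L \<delta>_def[symmetric] by (simp add: algebra_simps)
  ultimately show "real r * L \<le> 2 * (x / real M)" using r by simp
qed

text \<open>For two elements of one bin the fixed \<open>l\<close> cancels, so
  \<open>\<theta>\<close> times their difference is within \<open>1 / M\<close> of an integer.
  \<open>near_integer_imp_dvd\<close> then places the bin in a short progression modulo
  \<open>q\<close>.\<close>

lemma card_bin_le:
  fixes \<theta> x y L :: real and a :: int and q M W :: nat
  assumes q: "q > 0" "coprime a (int q)" and y: "y \<ge> 1"
    and L: "L = 1 + \<bar>\<theta> - of_int a / real q\<bar> * x" and x: "x \<ge> 0"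
    and M: "4 * real q * L \<le> real M" and W: "W \<ge> 2" "x / (real M * real q * L) \<le> real W"
    and C: "C \<subseteq> smooth_numbers (x / real M) y"
  shows "card {l'\<in>C. frac_bin M (\<theta> * (real l - real l')) = j} \<le> 3 * smooth_count (real W * y) y"
proof (rule card_smooth_progression_le[OF _ q(1) W(1) y])
  let ?D = "{l'\<in>C. frac_bin M (\<theta> * (real l - real l')) = j}"
  show "?D \<subseteq> smooth_numbers (x / real M) y" using C by auto
  have L1: "L \<ge> 1" using x unfolding L by simp
  have "4 * 1 * 1 \<le> 4 * real q * L" using q L1 by (intro mult_mono) auto
  hence M0: "real M > 0" using M by linarith
  fix l1 l2 assume l: "l1 \<in> ?D" "l2 \<in> ?D" "l2 \<le> l1"
  define u where "u = (\<lambda>l'. \<theta> * (real l - real l'))"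
  have b: "frac_bin M (u l1) = j" "frac_bin M (u l2) = j" using l by (auto simp: u_def)
  have "\<bar>real M * frac (u l1) - real M * frac (u l2)\<bar> < 1"
    using frac_bin[of M "u l1"] frac_bin[of M "u l2"] M0 b by auto
  hence "real M * \<bar>frac (u l2) - frac (u l1)\<bar> < 1"
    by (simp add: right_diff_distrib[symmetric] abs_mult abs_minus_commute)
  hence fr: "\<bar>frac (u l2) - frac (u l1)\<bar> < 1 / real M" using M0 by (simp add: field_simps)
  have "\<theta> * real (l1 - l2) = u l2 - u l1"
    using l(3) by (simp add: u_def of_nat_diff algebra_simps)
  also have "\<dots> - of_int (\<lfloor>u l2\<rfloor> - \<lfloor>u l1\<rfloor>) = frac (u l2) - frac (u l1)"
    by (simp add: frac_def)
  finally have k: "\<bar>\<theta> * real (l1 - l2) - of_int (\<lfloor>u l2\<rfloor> - \<lfloor>u l1\<rfloor>)\<bar> < 1 / real M"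
    using fr by simp
  have "real l1 \<le> x / real M" using l C by (auto simp: smooth_numbers_def)
  hence r: "real (l1 - l2) \<le> x / real M" by linarith
  note near = near_integer_imp_dvd[OF q L x M k r]
  have "real (l1 - l2) \<le> 2 * (x / real M) / L" using near(2) L1 by (subst pos_le_divide_eq) auto
  also have "\<dots> = 2 * real q * (x / (real M * real q * L))" using q by simp
  also have "\<dots> \<le> 2 * real q * real W" using W q by (intro mult_left_mono) auto
  finally have "real (l1 - l2) \<le> real (2 * q * W)" by simp
  hence "l1 - l2 \<le> 2 * q * W" by (simp only: of_nat_le_iff)
  thus "q dvd l1 - l2 \<and> l1 - l2 \<le> 2 * q * W" using near(1) by blast
qed

text \<open>There are at most \<open>y\<close> bilinear sums, one for each \<open>p\<close>. The
  factors under the root are the number of \<open>m\<close>, the number of \<open>l\<close>, the bin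
  size for a given \<open>l\<close>, and the loss from summing the geometric bounds over the
  bins.\<close>

proposition norm_smooth_exp_sum_le:
  fixes \<theta> x y L :: real and a :: int and q M W :: nat
  assumes q: "q > 0" "coprime a (int q)" and y: "y \<ge> 1"
    and L: "L = 1 + \<bar>\<theta> - of_int a / real q\<bar> * x" and x: "x \<ge> 0"
    and M: "4 * real q * L \<le> real M" and W: "W \<ge> 2" "x / (real M * real q * L) \<le> real W"
  shows "norm (smooth_exp_sum \<theta> x y) \<le> real M + y * sqrt (real M * y *
    (real (smooth_count (x / real M) y) * (real (3 * smooth_count (real W * y) y) *
      (2 * (real M * y) + real M * (1 + ln (real M))))))"
proof -
  have L1: "L \<ge> 1" using x unfolding L by simp
  have "4 * 1 * 1 \<le> 4 * real q * L" using q L1 by (intro mult_mono) auto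
  hence M2: "M \<ge> 2" using M by linarith
  define R where "R = nat \<lfloor>real M * y\<rfloor>"
  have R: "real R \<le> real M * y" using y by (simp add: R_def)
  define G where "G = 3 * smooth_count (real W * y) y"
  define Q where "Q = real M * y * (real (smooth_count (x / real M) y) * (real G *
      (2 * (real M * y) + real M * (1 + ln (real M)))))"
  have lnM: "ln (real M) \<ge> 0" using M2 by simp
  have bound: "norm (\<Sum>m\<in>lead_part M x y p. \<Sum>l | l \<in> rough_part M x y p \<and> real (m * l) \<le> x.
       add_char (\<theta> * real (m * l))) \<le> sqrt Q" for p
  proof (rule real_le_rsqrt)
    define C where "C = rough_part M x y p"
    have C: "finite C" "\<And>l. l \<in> C \<Longrightarrow> l > 0" "C \<subseteq> smooth_numbers (x / real M) y"
      by (auto simp: C_def rough_part_def) (auto simp: smooth_numbers_def)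
    have sub: "lead_part M x y p \<subseteq> {M..R}" unfolding R_def by (rule lead_part_subset[OF M2])
    have cardB: "real (card (lead_part M x y p)) \<le> real M * y"
    proof -
      have "card (lead_part M x y p) \<le> card {1..R}"
        using sub M2 by (intro card_mono) auto
      hence "real (card (lead_part M x y p)) \<le> real R" by simp
      thus ?thesis using R by linarith
    qed
    define F where "F = (\<lambda>l l'. norm (\<Sum>m=M..min R (nat \<lfloor>x / max (real l) (real l')\<rfloor>).
        add_char (\<theta> * (real l - real l') * real m)))"
    have inner: "(\<Sum>l'\<in>C. F l l') \<le> real G * (2 * (real M * y) + real M * (1 + ln (real M)))" for l
    proof -
      have "(\<Sum>l'\<in>C. F l l') \<le> real G * (2 * real R + real M * (1 + ln (real M)))"
      proof (rule sum_le_binned[where u = "\<lambda>l'. \<theta> * (real l - real l')"])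
        show "card {l'\<in>C. frac_bin M (\<theta> * (real l - real l')) = j} \<le> G" for j
          unfolding G_def by (rule card_bin_le[OF q y L x M W C(3)])
        show "F l l' \<le> real R" for l'
        proof -
          have "F l l' \<le> (\<Sum>m=M..min R (nat \<lfloor>x / max (real l) (real l')\<rfloor>). 1)"
            unfolding F_def by (rule order.trans[OF norm_sum]) simp
          also have "\<dots> \<le> (\<Sum>m=1..R. 1)" using M2 by (intro sum_mono2) auto
          finally show ?thesis by simp
        qed
        show "F l l' \<le> 1 / (2 * min (frac (\<theta> * (real l - real l'))) (1 - frac (\<theta> * (real l - real l'))))"
          if "frac (\<theta> * (real l - real l')) > 0" for l'
          unfolding F_def by (rule norm_sum_add_char_le[OF that])
      qed (use C M2 in auto)
      also have "\<dots> \<le> real G * (2 * (real M * y) + real M * (1 + ln (real M)))"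
        using R by (intro mult_left_mono) auto
      finally show ?thesis .
    qed
    have cardC: "real (card C) \<le> real (smooth_count (x / real M) y)"
      unfolding smooth_count_def using C by (intro of_nat_mono card_mono) auto
    have "(norm (\<Sum>m\<in>lead_part M x y p. \<Sum>l | l \<in> C \<and> real (m * l) \<le> x.
       add_char (\<theta> * real (m * l))))\<^sup>2 \<le> real (card (lead_part M x y p)) * (\<Sum>l\<in>C. \<Sum>l'\<in>C. F l l')"
      unfolding F_def using M2 by (intro norm_bilinear_sum_le[OF sub C(1) C(2) _ x]) auto
    also have "\<dots> \<le> real M * y * (\<Sum>l\<in>C. \<Sum>l'\<in>C. F l l')"
      using cardB by (intro mult_right_mono sum_nonneg) (auto simp: F_def)
    also have "\<dots> \<le> real M * y * (\<Sum>l\<in>C. real G * (2 * (real M * y) + real M * (1 + ln (real M))))"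
      using inner y by (intro mult_left_mono sum_mono) auto
    also have "\<dots> = real M * y * (real (card C) * (real G * (2 * (real M * y) + real M * (1 + ln (real M)))))"
      by simp
    also have "\<dots> \<le> Q"
      unfolding Q_def using y lnM cardC by (intro mult_left_mono mult_right_mono) auto
    finally show "(norm (\<Sum>m\<in>lead_part M x y p. \<Sum>l | l \<in> rough_part M x y p \<and> real (m * l) \<le> x.
       add_char (\<theta> * real (m * l))))\<^sup>2 \<le> Q" by (simp only: C_def)
  qed
  have Q0: "Q \<ge> 0" unfolding Q_def using y lnM by auto
  have "norm (smooth_exp_sum \<theta> x y) \<le> real M + (\<Sum>p=1..nat \<lfloor>y\<rfloor>.
     norm (\<Sum>m\<in>lead_part M x y p. \<Sum>l | l \<in> rough_part M x y p \<and> real (m * l) \<le> x.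
       add_char (\<theta> * real (m * l))))" by (rule norm_smooth_exp_sum_le_bilinear[OF M2])
  also have "\<dots> \<le> real M + (\<Sum>p=1..nat \<lfloor>y\<rfloor>. sqrt Q)" using bound by (intro add_left_mono sum_mono)
  also have "\<dots> \<le> real M + y * sqrt Q"
    using Q0 y by (simp add: mult_right_mono)
  finally show ?thesis by (simp only: Q_def G_def)
qed

section \<open>Pointwise bounds and moments\<close>

text \<open>The choices are \<open>M\<close> about \<open>4 * T\<close> and \<open>W\<close> about
  \<open>x / T\<^sup>2\<close>. The quantity under the root then carries
  \<open>T powr (2 - 3 * \<sigma>)\<close>: two factors \<open>T\<close> from lengths of ranges,
  \<open>T powr (-\<sigma>)\<close> from the count up to \<open>x / M\<close>, and
  \<open>T powr (-2 * \<sigma>)\<close> from the count up to \<open>W * y\<close>.\<close>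

lemma norm_smooth_exp_sum_le_powr:
  fixes x y \<sigma> E \<theta> T :: real and a :: int and q :: nat
  assumes y: "y \<ge> 1" "ln x \<le> y" "33 * y \<le> x" and x: "x \<ge> 400"
    and \<sigma>: "2 / 3 \<le> \<sigma>" "\<sigma> \<le> 1" and E: "E \<ge> 1"
    and count: "\<And>z. 0 < z \<Longrightarrow> z \<le> x\<^sup>2 \<Longrightarrow> real (smooth_count z y) \<le> E * z powr \<sigma>"
    and q: "q > 0" "coprime a (int q)"
    and T: "T = real q * (1 + \<bar>\<theta> - of_int a / real q\<bar> * x)" "T \<le> 4 * sqrt x"
  shows "norm (smooth_exp_sum \<theta> x y) \<le> 180 * y ^ 3 * E * x powr \<sigma> * T powr (1 - 3 * \<sigma> / 2)"
proof -
  define L where "L = 1 + \<bar>\<theta> - of_int a / real q\<bar> * x"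
  have L: "L \<ge> 1" using x by (simp add: L_def)
  have "1 * 1 \<le> real q * L" using q L by (intro mult_mono) auto
  hence T1: "T \<ge> 1" using T by (simp add: L_def)
  have TL: "T = real q * L" by (simp add: T L_def)
  have x0: "x > 0" using x by simp
  define M where "M = nat \<lceil>4 * T\<rceil>"
  have M: "4 * T \<le> real M" "real M \<le> 5 * T" using T1 unfolding M_def by linarith+
  have M1: "real M \<ge> 1" using M T1 by linarith
  have T2: "T\<^sup>2 \<le> 16 * x"
  proof -
    have "T\<^sup>2 \<le> (4 * sqrt x)\<^sup>2" using T T1 by (intro power_mono) auto
    thus ?thesis using x0 by (simp add: power_mult_distrib)
  qed
  have xT: "1 / 16 \<le> x / T\<^sup>2" using T2 T1 by (simp add: field_simps)
  define W where "W = nat \<lceil>x / T\<^sup>2\<rceil> + 1"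
  have W: "x / T\<^sup>2 \<le> real W" "real W \<le> x / T\<^sup>2 + 2" "W \<ge> 2" using xT unfolding W_def by linarith+
  \<comment> \<open>From \<open>T \<le> 4 * sqrt x\<close>, the quotient
    \<open>x / T\<^sup>2\<close> is at least 1/16, so the rounding error 2 is at most 32 times
    it.\<close>
  have W': "real W \<le> 33 * (x / T\<^sup>2)" using W xT by linarith
  have sx: "sqrt x \<ge> 20" using x real_le_rsqrt[of 20 x] by simp
  have Mx: "real M \<le> x"
  proof -
    have "real M \<le> 20 * sqrt x" using M T by linarith
    also have "\<dots> \<le> sqrt x * sqrt x" using sx x0 by (intro mult_right_mono) auto
    finally show ?thesis using x0 by simp
  qed
  have lnM: "0 \<le> ln (real M)" "ln (real M) \<le> y"
  proof -
    have "ln (real M) \<le> ln x" using M1 Mx x0 by (subst ln_le_cancel_iff) auto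
    thus "ln (real M) \<le> y" using y by linarith
  qed (use M1 in auto)
  have bound: "norm (smooth_exp_sum \<theta> x y) \<le> real M + y * sqrt (real M * y *
    (real (smooth_count (x / real M) y) * (real (3 * smooth_count (real W * y) y) *
      (2 * (real M * y) + real M * (1 + ln (real M))))))"
  proof (rule norm_smooth_exp_sum_le[OF q y(1) L_def _ _ W(3)])
    show "4 * real q * L \<le> real M" using M by (simp add: TL)
    have "x / (real M * real q * L) = x / (real M * T)" by (simp add: TL)
    also have "\<dots> \<le> x / (T * T)" using M T1 x0 by (intro divide_left_mono mult_right_mono) auto
    also have "\<dots> \<le> real W" using W by (simp add: power2_eq_square)
    finally show "x / (real M * real q * L) \<le> real W" .
  qed (use x0 in auto)
  have c1: "real (smooth_count (x / real M) y) \<le> E * (x powr \<sigma> * T powr (-\<sigma>))"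
  proof -
    have "x / real M \<le> x / 1" using x0 M1 by (intro divide_left_mono) auto
    also have "\<dots> \<le> x\<^sup>2" using x by (simp add: power2_eq_square)
    finally have "real (smooth_count (x / real M) y) \<le> E * (x / real M) powr \<sigma>"
      using x0 M1 by (intro count) auto
    also have "\<dots> \<le> E * (x / T) powr \<sigma>"
      using E x0 M T1 \<sigma> by (intro mult_left_mono powr_mono2 divide_left_mono) auto
    also have "(x / T) powr \<sigma> = x powr \<sigma> * T powr (-\<sigma>)"
      using x0 T1 by (simp add: powr_divide powr_minus field_simps)
    finally show ?thesis .
  qed
  have c2: "real (smooth_count (real W * y) y) \<le> E * (33 * y * (x powr \<sigma> * T powr (-2 * \<sigma>)))"
  proof -
    have "real W * y \<le> 33 * (x / T\<^sup>2) * y" using W' y by (intro mult_right_mono) auto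
    also have "\<dots> \<le> 33 * (x / 1) * y" using x0 T1 y by (intro mult_right_mono mult_left_mono divide_left_mono) auto
    also have "\<dots> = (33 * y) * x" by simp
    also have "\<dots> \<le> x * x" using y x0 by (intro mult_right_mono) auto
    finally have "real (smooth_count (real W * y) y) \<le> E * (real W * y) powr \<sigma>"
      using W y by (intro count) (auto simp: power2_eq_square)
    also have "\<dots> \<le> E * (33 * (x / T\<^sup>2) * y) powr \<sigma>"
      using E W' y \<sigma> by (intro mult_left_mono powr_mono2 mult_right_mono) auto
    also have "(33 * (x / T\<^sup>2) * y) powr \<sigma> = (33 * y) powr \<sigma> * (x / T\<^sup>2) powr \<sigma>"
      using x0 y T1 by (simp add: powr_mult[symmetric] mult_ac)
    also have "(x / T\<^sup>2) powr \<sigma> = x powr \<sigma> * T powr (-2 * \<sigma>)"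
    proof -
      have "T\<^sup>2 = T powr 2" using T1 by (simp add: powr_numeral)
      hence "(T\<^sup>2) powr \<sigma> = T powr (2 * \<sigma>)" by (simp add: powr_powr)
      thus ?thesis using x0 T1 by (simp add: powr_divide powr_minus field_simps)
    qed
    also have "E * ((33 * y) powr \<sigma> * (x powr \<sigma> * T powr (-2 * \<sigma>))) \<le>
               E * (33 * y * (x powr \<sigma> * T powr (-2 * \<sigma>)))"
      using E y \<sigma> powr_mono[of \<sigma> 1 "33 * y"] by (intro mult_left_mono mult_right_mono) auto
    finally show ?thesis .
  qed
  have c3: "2 * (real M * y) + real M * (1 + ln (real M)) \<le> 20 * (T * y)"
  proof -
    have "2 * (real M * y) + real M * (1 + ln (real M)) \<le> 2 * (real M * y) + real M * (y + y)"
      using lnM y by (intro add_left_mono mult_left_mono) auto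
    also have "\<dots> = 4 * y * real M" by (simp add: algebra_simps)
    also have "\<dots> \<le> 4 * y * (5 * T)" using M y by (intro mult_left_mono) auto
    also have "\<dots> = 20 * (T * y)" by simp
    finally show ?thesis .
  qed
  define A where "A = real M * y * (real (smooth_count (x / real M) y) * (real (3 * smooth_count (real W * y) y) *
      (2 * (real M * y) + real M * (1 + ln (real M)))))"
  have "A \<le> (5 * T) * y * ((E * (x powr \<sigma> * T powr (-\<sigma>))) * ((3 * (E * (33 * y * (x powr \<sigma> * T powr (-2 * \<sigma>))))) *
      (20 * (T * y))))"
    unfolding A_def using c1 c2 c3 M y T1 E lnM by (intro mult_mono) auto
  also have "\<dots> = 9900 * y ^ 3 * E\<^sup>2 * (x powr \<sigma>)\<^sup>2 * (T * T * (T powr (-\<sigma>) * T powr (-2 * \<sigma>)))"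
    by (simp add: power2_eq_square power3_eq_cube)
  also have "T * T * (T powr (-\<sigma>) * T powr (-2 * \<sigma>)) = (T powr (1 - 3 * \<sigma> / 2))\<^sup>2"
  proof -
    have "T * T * (T powr (-\<sigma>) * T powr (-2 * \<sigma>)) = T powr 1 * T powr 1 * (T powr (-\<sigma>) * T powr (-2 * \<sigma>))"
      using T1 by simp
    also have "\<dots> = T powr (2 * (1 - 3 * \<sigma> / 2))" unfolding powr_add[symmetric] by (simp add: algebra_simps)
    also have "\<dots> = (T powr (1 - 3 * \<sigma> / 2)) powr 2" by (simp add: powr_powr mult_ac)
    also have "\<dots> = (T powr (1 - 3 * \<sigma> / 2))\<^sup>2" using T1 by (simp add: powr_numeral)
    finally show ?thesis .
  qed
  \<comment> \<open>The constant is \<open>5 * 3 * 33 * 20\<close>. Raising it to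
    \<open>100\<^sup>2\<close> and \<open>y ^ 3\<close> to \<open>y ^ 4\<close> makes the bound a
    perfect square.\<close>
  also have "9900 * y ^ 3 * E\<^sup>2 * (x powr \<sigma>)\<^sup>2 * (T powr (1 - 3 * \<sigma> / 2))\<^sup>2 \<le>
             10000 * y ^ 4 * E\<^sup>2 * (x powr \<sigma>)\<^sup>2 * (T powr (1 - 3 * \<sigma> / 2))\<^sup>2"
    using y by (intro mult_right_mono mult_mono power_increasing) auto
  also have "\<dots> = (100 * y\<^sup>2 * E * x powr \<sigma> * T powr (1 - 3 * \<sigma> / 2))\<^sup>2"
    by (simp add: power_mult_distrib)
  finally have "sqrt A \<le> 100 * y\<^sup>2 * E * x powr \<sigma> * T powr (1 - 3 * \<sigma> / 2)"
    using E y by (intro real_le_lsqrt) auto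
  hence "y * sqrt A \<le> y * (100 * y\<^sup>2 * E * x powr \<sigma> * T powr (1 - 3 * \<sigma> / 2))"
    using y by (intro mult_left_mono) auto
  hence b1: "y * sqrt A \<le> 100 * (y ^ 3 * E * x powr \<sigma> * T powr (1 - 3 * \<sigma> / 2))"
    by (simp add: power2_eq_square power3_eq_cube mult_ac)
  \<comment> \<open>The trivial term also fits: \<open>T \<le> 4 * sqrt x\<close> gives
    \<open>T powr (3 * \<sigma> / 2) \<le> 16 * x powr \<sigma>\<close>. The final constant is 100 +
    80.\<close>
  have "real M \<le> 5 * T" by (rule M)
  also have "T = T powr (3 * \<sigma> / 2) * T powr (1 - 3 * \<sigma> / 2)"
    unfolding powr_add[symmetric] using T1 by simp
  also have "T powr (3 * \<sigma> / 2) \<le> 16 * x powr \<sigma>"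
  proof -
    have "T powr (3 * \<sigma> / 2) \<le> (4 * sqrt x) powr (3 * \<sigma> / 2)" using T T1 \<sigma> by (intro powr_mono2) auto
    also have "\<dots> = 4 powr (3 * \<sigma> / 2) * (x powr (1/2)) powr (3 * \<sigma> / 2)"
      using x0 by (simp add: powr_mult powr_half_sqrt)
    also have "\<dots> \<le> 4 powr 2 * x powr \<sigma>"
    proof (intro mult_mono)
      show "4 powr (3 * \<sigma> / 2) \<le> (4::real) powr 2" using \<sigma> by (intro powr_mono) auto
      show "(x powr (1/2)) powr (3 * \<sigma> / 2) \<le> x powr \<sigma>" unfolding powr_powr using x \<sigma> by (intro powr_mono) auto
    qed auto
    finally show ?thesis by simp
  qed
  also have "5 * (16 * x powr \<sigma> * T powr (1 - 3 * \<sigma> / 2)) = 80 * (1 * 1 * x powr \<sigma> * T powr (1 - 3 * \<sigma> / 2))"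
    by simp
  also have "\<dots> \<le> 80 * (y ^ 3 * E * x powr \<sigma> * T powr (1 - 3 * \<sigma> / 2))"
    using y E by (intro mult_left_mono mult_right_mono mult_mono one_le_power) auto
  finally have b2: "real M \<le> 80 * (y ^ 3 * E * x powr \<sigma> * T powr (1 - 3 * \<sigma> / 2))"
    by (simp add: mult_right_mono)
  show ?thesis using bound b1 b2 unfolding A_def[symmetric] by simp
qed

lemma integral_peak_le:
  fixes x s c :: real
  assumes x: "x > 0" and s: "s > 1" and c: "0 \<le> c" "c \<le> 1"
  shows "integral {0..1} (\<lambda>\<theta>. (1 + \<bar>\<theta> - c\<bar> * x) powr (-s)) \<le> 2 / (x * (s - 1))"
proof -
  define f where "f = (\<lambda>\<theta>. (1 + \<bar>\<theta> - c\<bar> * x) powr (-s))"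
  \<comment> \<open>\<open>F u\<close> is the integral of \<open>(1 + t * x) powr (-s)\<close> over
    \<open>t\<close> from \<open>u\<close> to infinity; it is finite since \<open>s > 1\<close>.
    Each side of the peak at \<open>c\<close> contributes at most \<open>F 0\<close>.\<close>
  define F where "F = (\<lambda>u. (1 + u * x) powr (1 - s) / (x * (s - 1)))"
  have xs: "x * (s - 1) > 0" using x s by simp
  have d: "((\<lambda>u. F u) has_real_derivative - ((1 + u * x) powr (-s))) (at u within S)" if "u \<ge> 0" for u S
  proof -
    have pos: "1 + u * x > 0" using that x by (simp add: add_pos_nonneg)
    have "((\<lambda>u. F u) has_real_derivative ((1 - s) * (1 + u * x) powr (1 - s - 1) * x) / (x * (s - 1))) (at u within S)"
      unfolding F_def by (rule derivative_eq_intros refl pos)+ (use pos x s in auto)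
    also have "((1 - s) * (1 + u * x) powr (1 - s - 1) * x) / (x * (s - 1)) = - ((1 + u * x) powr (-s))"
      using xs x s by (simp add: field_simps)
    finally show ?thesis .
  qed
  have 1: "(f has_integral F 0 - F c) {0..c}"
  proof -
    have "(f has_integral (\<lambda>\<theta>. F (c - \<theta>)) c - (\<lambda>\<theta>. F (c - \<theta>)) 0) {0..c}"
    proof (rule fundamental_theorem_of_calculus[OF c(1)])
      fix t assume t: "t \<in> {0..c}"
      have "((\<lambda>\<theta>. F (c - \<theta>)) has_real_derivative - ((1 + (c - t) * x) powr (-s)) * (- 1)) (at t within {0..c})"
        using t by (intro DERIV_chain'[where f = "\<lambda>\<theta>. c - \<theta>" and g = F] d) (auto intro!: derivative_eq_intros)
      thus "((\<lambda>\<theta>. F (c - \<theta>)) has_vector_derivative f t) (at t within {0..c})"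
        using t by (simp add: f_def has_real_derivative_iff_has_vector_derivative)
    qed
    thus ?thesis by simp
  qed
  have 2: "(f has_integral F 0 - F (1 - c)) {c..1}"
  proof -
    have "(f has_integral (\<lambda>\<theta>. - F (\<theta> - c)) 1 - (\<lambda>\<theta>. - F (\<theta> - c)) c) {c..1}"
    proof (rule fundamental_theorem_of_calculus[OF c(2)])
      fix t assume t: "t \<in> {c..1}"
      have "((\<lambda>\<theta>. F (\<theta> - c)) has_real_derivative - ((1 + (t - c) * x) powr (-s)) * 1) (at t within {c..1})"
        using t by (intro DERIV_chain'[where f = "\<lambda>\<theta>. \<theta> - c" and g = F] d) (auto intro!: derivative_eq_intros)
      hence "((\<lambda>\<theta>. - F (\<theta> - c)) has_real_derivative (1 + (t - c) * x) powr (-s)) (at t within {c..1})"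
        using DERIV_minus by fastforce
      thus "((\<lambda>\<theta>. - F (\<theta> - c)) has_vector_derivative f t) (at t within {c..1})"
        using t by (simp add: f_def has_real_derivative_iff_has_vector_derivative)
    qed
    thus ?thesis by simp
  qed
  have "(f has_integral (F 0 - F c) + (F 0 - F (1 - c))) {0..1}"
    by (rule has_integral_combine[OF c 1 2])
  hence "integral {0..1} f = (F 0 - F c) + (F 0 - F (1 - c))" by (rule integral_unique)
  also have "\<dots> \<le> 2 * F 0"
  proof -
    have "F u \<ge> 0" for u unfolding F_def using xs by (intro divide_nonneg_nonneg) auto
    from this[of c] this[of "1 - c"] show ?thesis by linarith
  qed
  also have "\<dots> = 2 / (x * (s - 1))" by (simp add: F_def)
  finally show ?thesis by (simp add: f_def)
qed

text \<open>Write the summand as \<open>1 / q\<close> times \<open>q powr (2 - s)\<close>. The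
  second factor is largest at \<open>sqrt x\<close> or at 1 according to the sign of
  \<open>2 - s\<close>; the two cases lead to the two terms of the moment bound.\<close>

lemma sum_powr_le:
  assumes x: "x \<ge> 1" and N: "1 \<le> N" "real N \<le> sqrt x"
  shows "(\<Sum>q=1..N. real q powr (1 - s)) \<le> (1 + ln x) * (1 + x powr (1 - s / 2))"
proof -
  have "(\<Sum>q=1..N. real q powr (1 - s)) \<le> (\<Sum>q=1..N. (1 / real q) * (1 + x powr (1 - s / 2)))"
  proof (intro sum_mono)
    fix q assume q: "q \<in> {1..N}"
    have "real q powr (1 - s) = (1 / real q) * real q powr (2 - s)"
      using q by (simp add: powr_diff field_simps power2_eq_square)
    also have "real q powr (2 - s) \<le> 1 + x powr (1 - s / 2)"
    proof (cases "s \<le> 2")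
      case True
      have "real q \<le> sqrt x" using q N by (meson atLeastAtMost_iff of_nat_mono order_trans)
      hence "real q powr (2 - s) \<le> (x powr (1/2)) powr (2 - s)"
        using True x by (intro powr_mono2) (auto simp: powr_half_sqrt)
      also have "\<dots> = x powr (1 - s / 2)" unfolding powr_powr by (simp add: field_simps)
      finally show ?thesis by simp
    next
      case False
      hence "real q powr (2 - s) \<le> real q powr 0" using q by (intro powr_mono) auto
      thus ?thesis using q by (simp add: add_increasing2)
    qed
    finally show "real q powr (1 - s) \<le> (1 / real q) * (1 + x powr (1 - s / 2))"
      by (simp add: divide_right_mono)
  qed
  also have "\<dots> = (\<Sum>q=1..N. 1 / real q) * (1 + x powr (1 - s / 2))" by (simp only: sum_distrib_right)
  also have "(\<Sum>q=1..N. 1 / real q) = 1 + (\<Sum>q=2..N. 1 / real q)"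
    using N by (subst sum.atLeast_Suc_atMost) (auto simp: numeral_2_eq_2)
  also have "\<dots> \<le> 1 + ln x"
  proof -
    have "sqrt x \<le> x" using x by (simp add: real_le_lsqrt power2_eq_square)
    hence "ln (real N) \<le> ln x" using N x by (subst ln_le_cancel_iff) auto
    thus ?thesis using sum_inverse_le_ln[OF N(1)] by linarith
  qed
  finally show ?thesis by (simp add: mult_right_mono)
qed

text \<open>Dirichlet's theorem with denominators up to \<open>N\<close>, the integer part of
  \<open>sqrt x\<close>. Since \<open>N \<ge> sqrt x / 2\<close>, the error times \<open>x\<close>
  is at most \<open>2 * sqrt x\<close>.\<close>

lemma dirichlet_arc:
  fixes \<theta> x :: real
  assumes x: "x \<ge> 4" and \<theta>: "0 \<le> \<theta>" "\<theta> \<le> 1"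
  obtains q a :: nat where "1 \<le> q" "q \<le> nat \<lfloor>sqrt x\<rfloor>" "a \<le> q" "coprime (int a) (int q)"
    "real q * (1 + \<bar>\<theta> - real a / real q\<bar> * x) \<le> 4 * sqrt x"
proof -
  define N where "N = nat \<lfloor>sqrt x\<rfloor>"
  have "sqrt x \<ge> 2" using x real_le_rsqrt[of 2 x] by simp
  hence N: "N \<ge> 1" "real N \<le> sqrt x" "sqrt x \<le> 2 * real N" unfolding N_def by linarith+
  obtain a q where aq: "coprime a q" "0 < q" "q \<le> int N" "\<bar>of_int q * \<theta> - of_int a\<bar> < 1 / N"
    using Dirichlet_approx_coprime[of N \<theta>] N by auto
  define q' where "q' = nat q"
  have q': "q = int q'" "q' \<ge> 1" "q' \<le> N" using aq by (auto simp: q'_def)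
  have "1 / real N \<le> 1" using N by simp
  moreover have "\<bar>real q' * \<theta> - of_int a\<bar> < 1 / real N" using aq q' by simp
  ultimately have lt: "\<bar>real q' * \<theta> - of_int a\<bar> < 1" by linarith
  have "real q' * \<theta> \<le> real q'" "0 \<le> real q' * \<theta>" using \<theta> by (auto simp: mult_left_le)
  \<comment> \<open>As \<open>q * \<theta>\<close> lies between 0 and \<open>q\<close>, an error
    below 1 forces the integer \<open>a\<close> into the same range.\<close>
  hence "of_int a < real q' + 1" "of_int a > (-1::real)" using lt by linarith+
  hence a: "a \<ge> 0" "a \<le> int q'" by linarith+
  define a' where "a' = nat a"
  have a': "a = int a'" "a' \<le> q'" using a by (auto simp: a'_def)
  have "real q' * (1 + \<bar>\<theta> - real a' / real q'\<bar> * x) = real q' + \<bar>real q' * \<theta> - real a'\<bar> * x"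
  proof -
    have "real q' * \<bar>\<theta> - real a' / real q'\<bar> = \<bar>real q' * (\<theta> - real a' / real q')\<bar>"
      by (simp add: abs_mult)
    also have "real q' * (\<theta> - real a' / real q') = real q' * \<theta> - real a'"
      using q' by (simp add: right_diff_distrib)
    finally show ?thesis by (simp add: distrib_left mult.assoc[symmetric])
  qed
  also have "\<dots> \<le> sqrt x + 1 / real N * x"
    using q' N aq(4) a' x by (intro add_mono mult_right_mono) auto
  also have "1 / real N * x \<le> 2 * sqrt x"
  proof -
    have "x = sqrt x * sqrt x" using x by simp
    also have "\<dots> \<le> 2 * real N * sqrt x" using N x by (intro mult_right_mono) auto
    finally show ?thesis using N by (simp add: field_simps)
  qed
  also have "sqrt x + 2 * sqrt x \<le> 4 * sqrt x" using x by simp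
  finally have "real q' * (1 + \<bar>\<theta> - real a' / real q'\<bar> * x) \<le> 4 * sqrt x" by simp
  thus ?thesis using that[of q' a'] q' a' aq(1) by (simp add: N_def)
qed

lemma integrable_norm_smooth_exp_sum_powr:
  "\<rho> > 0 \<Longrightarrow> (\<lambda>\<theta>. norm (smooth_exp_sum \<theta> x y) powr \<rho>) integrable_on {0..1}"
  unfolding smooth_exp_sum_def add_char_def
  by (intro integrable_continuous_real continuous_on_powr' continuous_intros) auto

lemma smooth_moment_nonneg: "\<rho> > 0 \<Longrightarrow> smooth_moment \<rho> x y \<ge> 0"
  unfolding smooth_moment_def
  by (intro integral_nonneg integrable_norm_smooth_exp_sum_powr) auto

text \<open>At every point the integrand is bounded by the peak at some fraction
  \<open>a / q\<close>, hence by the sum of all peaks, which are nonnegative. The arcs thus need not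
  be separated, and the integral splits into single peaks.\<close>

lemma smooth_moment_le:
  fixes x y \<rho> s A :: real
  assumes x: "x \<ge> 4" and \<rho>: "\<rho> > 0" and s: "s * \<rho> > 1" and A: "A \<ge> 0"
    and bound: "\<And>\<theta> a q. q > 0 \<Longrightarrow> coprime (int a) (int q) \<Longrightarrow>
      real q * (1 + \<bar>\<theta> - real a / real q\<bar> * x) \<le> 4 * sqrt x \<Longrightarrow>
      norm (smooth_exp_sum \<theta> x y) \<le> A * (real q * (1 + \<bar>\<theta> - real a / real q\<bar> * x)) powr (- s)"
  shows "smooth_moment \<rho> x y \<le>
    A powr \<rho> * (4 / (s * \<rho> - 1) * (1 + ln x) * (x powr (-1) + x powr (- (s * \<rho> / 2))))"
proof -
  define N where "N = nat \<lfloor>sqrt x\<rfloor>"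
  define r where "r = s * \<rho>"
  define f where "f = (\<lambda>(q::nat) (a::nat) \<theta>. (real q * (1 + \<bar>\<theta> - real a / real q\<bar> * x)) powr (- r))"
  have "sqrt x \<ge> 2" using x real_le_rsqrt[of 2 x] by simp
  hence N: "N \<ge> 1" "real N \<le> sqrt x" unfolding N_def by linarith+
  have pos: "1 + \<bar>\<theta> - c\<bar> * x > 0" for \<theta> c using x by (simp add: add_pos_nonneg)
  have intf: "f q a integrable_on {0..1}" if "q \<ge> 1" for q a
    unfolding f_def using that pos x
    by (intro integrable_continuous_real continuous_intros) (auto simp: less_imp_neq[symmetric] intro: order.strict_implies_not_eq)
  have If: "integral {0..1} (f q a) \<le> real q powr (- r) * (2 / (x * (r - 1)))" if "q \<ge> 1" "a \<le> q" for q a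
  proof -
    have "f q a = (\<lambda>\<theta>. real q powr (- r) * (1 + \<bar>\<theta> - real a / real q\<bar> * x) powr (- r))"
      unfolding f_def using less_imp_le[OF pos] by (intro ext powr_mult)
    hence "integral {0..1} (f q a) = real q powr (- r) * integral {0..1} (\<lambda>\<theta>. (1 + \<bar>\<theta> - real a / real q\<bar> * x) powr (- r))"
      by simp
    also have "\<dots> \<le> real q powr (- r) * (2 / (x * (r - 1)))"
      using that x s by (intro mult_left_mono integral_peak_le) (auto simp: r_def)
    finally show ?thesis .
  qed
  have int1: "(\<lambda>\<theta>. norm (smooth_exp_sum \<theta> x y) powr \<rho>) integrable_on {0..1}"
    by (rule integrable_norm_smooth_exp_sum_powr[OF \<rho>])
  have int2: "(\<lambda>\<theta>. A powr \<rho> * (\<Sum>q=1..N. \<Sum>a\<le>q. f q a \<theta>)) integrable_on {0..1}"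
    using intf by (intro integrable_on_mult_right integrable_sum) auto
  have "smooth_moment \<rho> x y \<le> integral {0..1} (\<lambda>\<theta>. A powr \<rho> * (\<Sum>q=1..N. \<Sum>a\<le>q. f q a \<theta>))"
    unfolding smooth_moment_def
  proof (rule integral_le[OF int1 int2])
    fix \<theta> :: real assume "\<theta> \<in> {0..1}"
    then obtain q a where qa: "1 \<le> q" "q \<le> N" "a \<le> q" "coprime (int a) (int q)"
       "real q * (1 + \<bar>\<theta> - real a / real q\<bar> * x) \<le> 4 * sqrt x"
      using dirichlet_arc[OF x, of \<theta>] unfolding N_def by auto
    define T where "T = real q * (1 + \<bar>\<theta> - real a / real q\<bar> * x)"
    have "norm (smooth_exp_sum \<theta> x y) powr \<rho> \<le> (A * T powr (- s)) powr \<rho>"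
      unfolding T_def using qa \<rho> by (intro powr_mono2 bound) auto
    also have "\<dots> = A powr \<rho> * f q a \<theta>"
      using A by (simp add: powr_mult powr_powr f_def T_def r_def)
    also have "f q a \<theta> \<le> (\<Sum>a\<le>q. f q a \<theta>)"
      using qa by (intro member_le_sum) (auto simp: f_def)
    also have "\<dots> \<le> (\<Sum>q=1..N. \<Sum>a\<le>q. f q a \<theta>)"
      using qa by (intro member_le_sum[where f = "\<lambda>q. \<Sum>a\<le>q. f q a \<theta>"] sum_nonneg) (auto simp: f_def)
    finally show "norm (smooth_exp_sum \<theta> x y) powr \<rho> \<le> A powr \<rho> * (\<Sum>q=1..N. \<Sum>a\<le>q. f q a \<theta>)"
      by (simp add: mult_left_mono)
  qed
  also have "\<dots> = A powr \<rho> * (\<Sum>q=1..N. \<Sum>a\<le>q. integral {0..1} (f q a))"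
  proof -
    have "integral {0..1} (\<lambda>\<theta>. \<Sum>q=1..N. \<Sum>a\<le>q. f q a \<theta>) =
          (\<Sum>q=1..N. integral {0..1} (\<lambda>\<theta>. \<Sum>a\<le>q. f q a \<theta>))"
      using intf by (intro integral_sum integrable_sum) auto
    also have "\<dots> = (\<Sum>q=1..N. \<Sum>a\<le>q. integral {0..1} (f q a))"
      using intf by (intro sum.cong[OF refl] integral_sum) auto
    finally show ?thesis by simp
  qed
  also have "(\<Sum>q=1..N. \<Sum>a\<le>q. integral {0..1} (f q a)) \<le>
      (\<Sum>q=1..N. 2 * real q * (real q powr (- r) * (2 / (x * (r - 1)))))"
  proof (intro sum_mono)
    fix q assume q: "q \<in> {1..N}"
    have "(\<Sum>a\<le>q. integral {0..1} (f q a)) \<le> (\<Sum>a\<le>q. real q powr (- r) * (2 / (x * (r - 1))))"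
      using q by (intro sum_mono If) auto
    also have "\<dots> = (real q + 1) * (real q powr (- r) * (2 / (x * (r - 1))))" by simp
    \<comment> \<open>There are \<open>q + 1\<close> numerators, as both 0 and \<open>q\<close> are
      allowed.\<close>
    also have "\<dots> \<le> 2 * real q * (real q powr (- r) * (2 / (x * (r - 1))))"
      using q x s by (intro mult_right_mono) (auto simp: r_def)
    finally show "(\<Sum>a\<le>q. integral {0..1} (f q a)) \<le> \<dots>" .
  qed
  also have "\<dots> = 4 / (x * (r - 1)) * (\<Sum>q=1..N. real q powr (1 - r))"
    unfolding sum_distrib_left by (intro sum.cong refl) (auto simp: powr_diff powr_minus field_simps)
  also have "\<dots> \<le> 4 / (x * (r - 1)) * ((1 + ln x) * (1 + x powr (1 - r / 2)))"
    using x s N by (intro mult_left_mono sum_powr_le) (auto simp: r_def)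
  also have "\<dots> = 4 / (r - 1) * (1 + ln x) * ((1 + x powr (1 - r / 2)) / x)"
    by (simp only: times_divide_eq_left times_divide_eq_right divide_divide_eq_left mult_ac)
  also have "(1 + x powr (1 - r / 2)) / x = x powr (-1) + x powr (- (r / 2))"
  proof -
    have "x powr (1 - r / 2) = x * x powr (- (r / 2))"
      using x powr_add[of x 1 "- (r / 2)"] by simp
    moreover have "(1 + x * u) / x = x powr (-1) + u" for u
      using x by (simp add: powr_minus field_simps)
    ultimately show ?thesis by simp
  qed
  finally show ?thesis by (simp add: r_def mult_left_mono)
qed

section \<open>Asymptotics\<close>

text \<open>Powers of \<open>y\<close> are compared with powers of \<open>ln x\<close>: \<open>y powr a\<close> is \<open>ln x\<close> to the power
  \<open>(K + h) * a\<close>, an exponent that tends to \<open>K * a\<close>.\<close>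

locale smoothness_bound =
  fixes K :: real and y h :: "real \<Rightarrow> real"
  assumes K: "K > 3"
    and h: "(h \<longlongrightarrow> 0) at_top"
    and y: "eventually (\<lambda>x. y x = ln x powr (K + h x)) at_top"
begin

lemma eventually_exponent_less:
  assumes "K * a < b"
  shows "eventually (\<lambda>x. (K + h x) * a < b) at_top"
proof -
  have "((\<lambda>x. (K + h x) * a) \<longlongrightarrow> (K + 0) * a) at_top" by (intro tendsto_intros h)
  thus ?thesis using assms by (intro order_tendstoD(2)) auto
qed

lemma eventually_exponent_greater:
  assumes "b < K * a"
  shows "eventually (\<lambda>x. b < (K + h x) * a) at_top"
proof -
  have "((\<lambda>x. (K + h x) * a) \<longlongrightarrow> (K + 0) * a) at_top" by (intro tendsto_intros h)
  thus ?thesis using assms by (intro order_tendstoD(1)) auto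
qed

lemma eventually_y_powr_le:
  assumes "K * a < b"
  shows "eventually (\<lambda>x. y x powr a \<le> ln x powr b) at_top"
proof -
  have "eventually (\<lambda>x::real. ln x \<ge> 1) at_top" by real_asymp
  thus ?thesis using eventually_exponent_less[OF assms] y
  proof eventually_elim
    case (elim x)
    have "y x powr a = ln x powr ((K + h x) * a)" using elim by (simp add: powr_powr)
    also have "\<dots> \<le> ln x powr b" using elim by (intro powr_mono) auto
    finally show ?case .
  qed
qed

lemma eventually_y_powr_ge:
  assumes "b < K * a"
  shows "eventually (\<lambda>x. ln x powr b \<le> y x powr a) at_top"
proof -
  have "eventually (\<lambda>x::real. ln x \<ge> 1) at_top" by real_asymp
  thus ?thesis using eventually_exponent_greater[OF assms] y
  proof eventually_elim
    case (elim x)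
    have "ln x powr b \<le> ln x powr ((K + h x) * a)" using elim by (intro powr_mono) auto
    also have "\<dots> = y x powr a" using elim by (simp add: powr_powr)
    finally show ?case .
  qed
qed

lemma eventually_y_ge_ln_cube: "eventually (\<lambda>x. ln x powr 3 \<le> y x) at_top"
proof -
  have "eventually (\<lambda>x::real. ln x \<ge> 1) at_top" by real_asymp
  moreover have "eventually (\<lambda>x. ln x powr 3 \<le> y x powr 1) at_top"
    using K by (intro eventually_y_powr_ge) auto
  ultimately show ?thesis using y by eventually_elim simp
qed

lemma eventually_y_ge: "eventually (\<lambda>x. c \<le> y x) at_top"
proof -
  have "eventually (\<lambda>x::real. c \<le> ln x powr 3) at_top" by real_asymp
  thus ?thesis using eventually_y_ge_ln_cube by eventually_elim linarith
qed

lemma eventually_ln_le_y: "eventually (\<lambda>x. ln x \<le> y x) at_top"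
proof -
  have "eventually (\<lambda>x::real. ln x \<le> ln x powr 3) at_top" by real_asymp
  thus ?thesis using eventually_y_ge_ln_cube by eventually_elim linarith
qed

lemma eventually_y_le_powr:
  assumes "\<epsilon> > 0"
  shows "eventually (\<lambda>x. y x \<le> x powr \<epsilon>) at_top"
proof -
  have "eventually (\<lambda>x. y x powr 1 \<le> ln x powr (K + 1)) at_top"
    by (intro eventually_y_powr_le) auto
  moreover have "eventually (\<lambda>x. ln x powr (K + 1) \<le> x powr \<epsilon>) at_top"
    using K assms by real_asymp
  ultimately show ?thesis using eventually_y_ge[of 1] by eventually_elim simp
qed

lemma eventually_ln_y_le: "eventually (\<lambda>x. ln (y x) \<le> (K + 1) * ln (ln x)) at_top"
proof -
  have "eventually (\<lambda>x. y x powr 1 \<le> ln x powr (K + 1)) at_top"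
    by (intro eventually_y_powr_le) auto
  moreover have "eventually (\<lambda>x::real. ln x > 0) at_top" by real_asymp
  ultimately show ?thesis using eventually_y_ge[of 1]
  proof eventually_elim
    case (elim x)
    hence "ln (y x) \<le> ln (ln x powr (K + 1))" by (subst ln_le_cancel_iff) auto
    thus ?case using elim by (simp add: ln_powr)
  qed
qed

text \<open>Rankin's bound at an exponent slightly above \<open>1 - 1 / K\<close>: there
  \<open>y powr (1 - s)\<close> is a power of \<open>ln x\<close> with exponent below 1, so the
  exponential factor is at most \<open>x powr (\<epsilon> / 2)\<close>, uniformly in
  \<open>z\<close>.\<close>

lemma eventually_smooth_count_le:
  assumes \<epsilon>: "0 < \<epsilon>" "\<epsilon> \<le> 1 / K"
  shows "eventually (\<lambda>x. \<forall>z. 0 < z \<longrightarrow> z \<le> x\<^sup>2 \<longrightarrow>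
    real (smooth_count z (y x)) \<le> x powr \<epsilon> * z powr (1 - 1 / K)) at_top"
proof -
  \<comment> \<open>The excess \<open>\<epsilon> / 4\<close> costs a factor
    \<open>z powr (\<epsilon> / 4)\<close>, at most \<open>x powr (\<epsilon> / 2)\<close> because
    \<open>z \<le> x\<^sup>2\<close>. With \<open>\<eta>\<close> as below,
    \<open>K * (1 - s) = 1 - 2 * \<eta>\<close>.\<close>
  define s where "s = 1 - 1 / K + \<epsilon> / 4"
  define \<eta> where "\<eta> = K * \<epsilon> / 8"
  have \<eta>: "\<eta> > 0" using K \<epsilon> by (simp add: \<eta>_def)
  have "1 / K \<le> 1 / 3" using K by (intro divide_left_mono) auto
  hence s: "1 / 2 \<le> s" "s \<le> 1" using \<epsilon> by (auto simp: s_def)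
  have "K * (1 - s) = 1 - 2 * \<eta>" using K by (simp add: s_def \<eta>_def field_simps)
  hence "eventually (\<lambda>x. y x powr (1 - s) \<le> ln x powr (1 - \<eta>)) at_top"
    using \<eta> by (intro eventually_y_powr_le) auto
  moreover have "eventually (\<lambda>x. 4 * (ln x powr (1 - \<eta>) * ((K + 1) * ln (ln x))) \<le> \<epsilon> / 2 * ln x) at_top"
    using K \<eta> \<epsilon> by real_asymp
  moreover have "eventually (\<lambda>x::real. x \<ge> 1) at_top" by real_asymp
  ultimately show ?thesis using eventually_y_ge[of 1] eventually_ln_y_le
  proof eventually_elim
    case (elim x)
    have "y x powr (1 - s) * ln (y x) \<le> ln x powr (1 - \<eta>) * ((K + 1) * ln (ln x))"
      using elim by (intro mult_mono) auto
    hence "4 * (y x powr (1 - s) * ln (y x)) \<le> \<epsilon> / 2 * ln x" using elim by linarith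
    hence "exp (4 * (y x powr (1 - s) * ln (y x))) \<le> exp (\<epsilon> / 2 * ln x)" by simp
    also have "\<dots> = x powr (\<epsilon> / 2)" using elim by (simp add: powr_def)
    finally have e: "exp (4 * (y x powr (1 - s) * ln (y x))) \<le> x powr (\<epsilon> / 2)" .
    show ?case
    proof safe
      fix z :: real assume z: "0 < z" "z \<le> x\<^sup>2"
      have "real (smooth_count z (y x)) \<le> z powr s * exp (4 * (y x powr (1 - s) * ln (y x)))"
        using elim by (intro rankin_bound s z) auto
      also have "\<dots> \<le> z powr s * x powr (\<epsilon> / 2)" using e by (intro mult_left_mono) auto
      also have "z powr s = z powr (1 - 1 / K) * z powr (\<epsilon> / 4)" by (simp add: s_def powr_add)
      also have "z powr (\<epsilon> / 4) \<le> (x\<^sup>2) powr (\<epsilon> / 4)" using z \<epsilon> by (intro powr_mono2) auto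
      also have "(x\<^sup>2) powr (\<epsilon> / 4) = x powr (\<epsilon> / 2)"
        using elim by (simp add: powr_powr flip: powr_numeral)
      also have "z powr (1 - 1 / K) * x powr (\<epsilon> / 2) * x powr (\<epsilon> / 2) = x powr \<epsilon> * z powr (1 - 1 / K)"
        by (simp add: mult.assoc flip: powr_add)
      finally show "real (smooth_count z (y x)) \<le> x powr \<epsilon> * z powr (1 - 1 / K)"
        by (simp add: mult_left_mono mult_right_mono)
    qed
  qed
qed

text \<open>Use products of \<open>k\<close> primes with \<open>k\<close> about
  \<open>ln x / ln y\<close>. There are at least \<open>(c / k) ^ k\<close> of them, where
  \<open>c\<close> counts the primes up to \<open>y\<close>, and Chebyshev's bound makes
  \<open>c / k\<close> at least \<open>y / (2 * ln x)\<close>.\<close>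

lemma eventually_smooth_count_ge:
  assumes \<epsilon>: "0 < \<epsilon>" "\<epsilon> \<le> 1 / 2"
  shows "eventually (\<lambda>x. x powr (1 - 1 / K - \<epsilon>) \<le> real (smooth_count x (y x))) at_top"
proof -
  \<comment> \<open>Half of \<open>\<epsilon>\<close> is spent on replacing
    \<open>y / (2 * ln x)\<close> by \<open>y powr b\<close>, the other half on rounding
    \<open>k\<close> down.\<close>
  define b where "b = 1 - 1 / K - \<epsilon> / 2"
  have "1 / K \<le> 1 / 3" using K by (intro divide_left_mono) auto
  moreover have "1 / K > 0" using K by simp
  ultimately have b: "0 < b" "b \<le> 1" using \<epsilon> unfolding b_def by linarith+
  define \<eta> where "\<eta> = K * \<epsilon> / 4"
  have \<eta>: "\<eta> > 0" using K \<epsilon> by (simp add: \<eta>_def)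
  have "K * (1 - b) = 1 + 2 * \<eta>" using K by (simp add: b_def \<eta>_def field_simps)
  hence "eventually (\<lambda>x. ln x powr (1 + \<eta>) \<le> y x powr (1 - b)) at_top"
    using \<eta> by (intro eventually_y_powr_ge) auto
  moreover have "eventually (\<lambda>x. 2 * ln x \<le> ln x powr (1 + \<eta>)) at_top"
    using \<eta> by real_asymp
  moreover have "eventually (\<lambda>x::real. x > 1) at_top" by real_asymp
  moreover have "eventually (\<lambda>x::real. ln x > 0) at_top" by real_asymp
  moreover have "eventually (\<lambda>x. y x \<le> x powr (\<epsilon> / 2)) at_top"
    using \<epsilon> by (intro eventually_y_le_powr) auto
  ultimately show ?thesis using eventually_y_ge[of 12]
  proof eventually_elim
    case (elim x)
    define Y where "Y = y x"
    have Y: "Y \<ge> 12" "Y \<le> x powr (\<epsilon> / 2)" using elim by (auto simp: Y_def)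
    have x: "x > 1" "ln x > 0" using elim by auto
    have lnY: "ln Y > 0" using Y by simp
    have "x powr (\<epsilon> / 2) \<le> x powr 1" using x \<epsilon> by (intro powr_mono) auto
    hence Yx: "Y \<le> x" using Y x by simp
    define c where "c = card {p::nat. prime p \<and> real p \<le> Y}"
    define k where "k = nat \<lfloor>ln x / ln Y\<rfloor>"
    have "ln Y \<le> ln x" using Yx Y by simp
    hence "1 \<le> ln x / ln Y" using lnY by (simp add: field_simps)
    hence k: "k \<ge> 1" "real k \<le> ln x / ln Y" "ln x / ln Y \<le> real k + 1" unfolding k_def by linarith+
    \<comment> \<open>With \<open>ln 4 \<ge> 4 / 3\<close> this is the inequality that requires
      \<open>Y \<ge> 12\<close>.\<close>
    have "Y / 2 \<le> (Y - 3) / 2 * ln 4"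
    proof -
      have "4 / 3 \<le> ln (4::real)"
      proof -
        have "ln (4::real) = 2 * ln 2" using ln_realpow[of 2 2] by simp
        thus ?thesis using ln2_ge_two_thirds by simp
      qed
      hence "(Y - 3) / 2 * (4 / 3) \<le> (Y - 3) / 2 * ln 4" using Y by (intro mult_left_mono) auto
      thus ?thesis using Y by simp
    qed
    also have "\<dots> \<le> real c * ln Y" unfolding c_def using Y by (intro prime_count_lower_bound) auto
    finally have "Y / 2 \<le> real c * ln Y" .
    hence "Y / 2 * real k \<le> real c * ln Y * (ln x / ln Y)"
      using k Y lnY by (intro mult_mono) auto
    hence "Y / 2 * real k \<le> real c * ln x" using lnY by simp
    hence "Y / (2 * ln x) \<le> real c / real k" using k x by (simp add: field_simps)
    moreover have "Y powr b \<le> Y / (2 * ln x)"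
    proof -
      have "2 * ln x \<le> Y powr (1 - b)" using elim by (simp add: Y_def)
      hence "2 * ln x * Y powr b \<le> Y powr (1 - b) * Y powr b" by (intro mult_right_mono) auto
      also have "\<dots> = Y" using Y by (simp flip: powr_add)
      finally show ?thesis using x by (simp add: field_simps)
    qed
    ultimately have ck: "Y powr b \<le> real c / real k" by linarith
    have "1 \<le> Y powr b" using Y b by (intro ge_one_powr_ge_zero) auto
    hence "1 \<le> real c / real k" using ck by linarith
    hence kc: "k \<le> c" using k by (simp add: field_simps)
    have "ln x \<le> (real k + 1) * ln Y" using k lnY by (simp add: field_simps)
    have Yk: "Y ^ k \<le> x"
    proof -
      have "real k * ln Y \<le> ln x" using k lnY by (simp add: field_simps)
      hence "ln (Y ^ k) \<le> ln x" using Y by (simp add: ln_realpow)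
      thus ?thesis using Y x by (subst (asm) ln_le_cancel_iff) auto
    qed
    have "x powr (1 - 1 / K - \<epsilon>) = x powr b * x powr (- (\<epsilon> / 2))"
      by (simp add: b_def flip: powr_add)
    \<comment> \<open>Rounding \<open>k\<close> down loses at most one factor
      \<open>Y powr b\<close>, which is at most \<open>x powr (\<epsilon> / 2)\<close>.\<close>
    also have "\<dots> \<le> x powr b * Y powr (- b)"
    proof (intro mult_left_mono)
      have "Y powr b \<le> Y powr 1" using Y b by (intro powr_mono) auto
      also have "\<dots> \<le> x powr (\<epsilon> / 2)" using Y by simp
      finally show "x powr (- (\<epsilon> / 2)) \<le> Y powr (- b)"
        using Y x by (simp add: powr_minus field_simps)
    qed auto
    also have "\<dots> = exp (b * (ln x - ln Y))"
      using x Y by (simp add: powr_def algebra_simps flip: exp_add)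
    also have "\<dots> \<le> exp (b * (real k * ln Y))"
    proof -
      have "ln x - ln Y \<le> real k * ln Y"
        using \<open>ln x \<le> (real k + 1) * ln Y\<close> by (simp add: algebra_simps)
      thus ?thesis using b by simp
    qed
    also have "\<dots> = (Y powr b) ^ k" using Y by (simp add: powr_def exp_of_nat_mult[symmetric] mult_ac)
    also have "\<dots> \<le> (real c / real k) ^ k" using ck by (intro power_mono) auto
    also have "\<dots> \<le> real (c choose k)" using kc by (rule binomial_ge_n_over_k_pow_k)
    also have "\<dots> \<le> real (smooth_count x Y)"
      unfolding c_def using Y Yk by (intro of_nat_mono smooth_count_ge_binomial) auto
    finally show ?case by (simp add: Y_def)
  qed
qed

text \<open>The pointwise bound with \<open>E = x powr \<delta>\<close>, in which
  \<open>x powr \<sigma>\<close> is traded for the smooth count by the lower bound. The exponent of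
  \<open>T\<close> equals \<open>-2 * \<beta>\<close>.\<close>

lemma eventually_norm_smooth_exp_sum_le:
  assumes \<epsilon>: "0 < \<epsilon>"
  defines "\<sigma> \<equiv> 1 - 1 / K"
  shows "eventually (\<lambda>x. \<forall>\<theta> (a::int) (q::nat). q > 0 \<longrightarrow> coprime a (int q) \<longrightarrow>
      real q * (1 + \<bar>\<theta> - of_int a / real q\<bar> * x) \<le> 4 * sqrt x \<longrightarrow>
      norm (smooth_exp_sum \<theta> x (y x)) \<le> x powr \<epsilon> * real (smooth_count x (y x)) *
        (real q * (1 + \<bar>\<theta> - of_int a / real q\<bar> * x)) powr (1 - 3 * \<sigma> / 2)) at_top"
proof -
  \<comment> \<open>Four factors \<open>x powr \<delta>\<close> are spent: on the constant 180, on
    \<open>y ^ 3\<close>, on \<open>E\<close>, and on the lower bound for the count.\<close>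
  define \<delta> where "\<delta> = min (\<epsilon> / 4) (min (1 / K) (1 / 2))"
  have "\<delta> \<le> \<epsilon> / 4" "\<delta> \<le> 1 / K" "\<delta> \<le> 1 / 2" unfolding \<delta>_def by linarith+
  moreover have "0 < \<delta>" using \<epsilon> K by (simp add: \<delta>_def)
  ultimately have \<delta>: "0 < \<delta>" "\<delta> \<le> 1 / K" "\<delta> \<le> 1 / 2" "4 * \<delta> \<le> \<epsilon>" by simp_all
  have "1 / K \<le> 1 / 3" using K by (intro divide_left_mono) auto
  hence \<sigma>: "2 / 3 \<le> \<sigma>" "\<sigma> \<le> 1" using K by (auto simp: \<sigma>_def)
  have "eventually (\<lambda>x::real. 180 \<le> x powr \<delta>) at_top" using \<delta> by real_asymp
  moreover have "eventually (\<lambda>x::real. x \<ge> 400) at_top" by real_asymp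
  moreover have "eventually (\<lambda>x::real. 33 * x powr (1/2) \<le> x) at_top" by real_asymp
  moreover have "eventually (\<lambda>x. y x \<le> x powr (1/2)) at_top" by (intro eventually_y_le_powr) auto
  moreover have "eventually (\<lambda>x. y x \<le> x powr (\<delta> / 3)) at_top" using \<delta> by (intro eventually_y_le_powr) auto
  ultimately show ?thesis
    using eventually_smooth_count_le[OF \<delta>(1,2)] eventually_smooth_count_ge[OF \<delta>(1,3)]
      eventually_y_ge[of 1] eventually_ln_le_y
  proof eventually_elim
    case (elim x)
    have E: "x powr \<delta> \<ge> 1" using elim \<delta> by (intro ge_one_powr_ge_zero) auto
    have "180 * y x ^ 3 * x powr \<delta> * x powr \<sigma> \<le> x powr \<delta> * x powr \<delta> * x powr \<delta> * x powr \<sigma>"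
    proof (intro mult_right_mono mult_mono)
      have "y x ^ 3 \<le> (x powr (\<delta> / 3)) ^ 3" using elim by (intro power_mono) auto
      also have "\<dots> = x powr \<delta>" using elim by (simp add: powr_powr flip: powr_numeral)
      finally show "y x ^ 3 \<le> x powr \<delta>" .
    qed (use elim in auto)
    also have "\<dots> = x powr (4 * \<delta>) * x powr (\<sigma> - \<delta>)" by (simp flip: powr_add)
    also have "\<dots> \<le> x powr \<epsilon> * real (smooth_count x (y x))"
      using elim \<delta> by (intro mult_mono powr_mono) (auto simp: \<sigma>_def)
    finally have le: "180 * y x ^ 3 * x powr \<delta> * x powr \<sigma> \<le> x powr \<epsilon> * real (smooth_count x (y x))" .
    show ?case
    proof safe
      fix \<theta> :: real and a :: int and q :: nat
      define T where "T = real q * (1 + \<bar>\<theta> - of_int a / real q\<bar> * x)"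
      assume q: "q > 0" "coprime a (int q)" and T: "real q * (1 + \<bar>\<theta> - of_int a / real q\<bar> * x) \<le> 4 * sqrt x"
      have "norm (smooth_exp_sum \<theta> x (y x)) \<le>
          180 * y x ^ 3 * x powr \<delta> * x powr \<sigma> * T powr (1 - 3 * \<sigma> / 2)"
      proof (rule norm_smooth_exp_sum_le_powr[OF _ _ _ _ \<sigma> E _ q T_def])
        show "real (smooth_count z (y x)) \<le> x powr \<delta> * z powr \<sigma>" if "0 < z" "z \<le> x\<^sup>2" for z
          using elim that by (simp add: \<sigma>_def)
      qed (use elim T in \<open>auto simp: T_def\<close>)
      also have "\<dots> \<le> x powr \<epsilon> * real (smooth_count x (y x)) * T powr (1 - 3 * \<sigma> / 2)"
        using le by (intro mult_right_mono) auto
      finally show "norm (smooth_exp_sum \<theta> x (y x)) \<le> x powr \<epsilon> * real (smooth_count x (y x)) *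
        (real q * (1 + \<bar>\<theta> - of_int a / real q\<bar> * x)) powr (1 - 3 * \<sigma> / 2)" by (simp add: T_def)
    qed
  qed
qed

lemma eventually_smooth_moment_le:
  fixes \<rho> \<beta> :: real
  assumes \<beta>: "\<beta> = (1 - 3 * (1 / K)) / 4" and \<rho>: "\<rho> > 0" "\<beta> * \<rho> > 1 / 2" and \<epsilon>: "0 < \<epsilon>"
  shows "eventually (\<lambda>x. smooth_moment \<rho> x (y x) \<le> x powr \<epsilon> *
    (real (smooth_count x (y x)) powr \<rho> * x powr (-1) +
     real (smooth_count x (y x)) powr \<rho> * x powr (- (\<beta> * \<rho>)))) at_top"
proof -
  \<comment> \<open>Raised to the power \<open>\<rho>\<close>, the loss
    \<open>x powr \<delta>\<close> becomes \<open>x powr (\<epsilon> / 2)\<close>; the other half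
    absorbs the constant and the logarithm.\<close>
  define \<delta> where "\<delta> = \<epsilon> / (2 * \<rho>)"
  have \<delta>: "\<delta> > 0" "\<delta> * \<rho> = \<epsilon> / 2" using \<epsilon> \<rho> by (auto simp: \<delta>_def)
  define s where "s = 2 * \<beta>"
  have s: "s * \<rho> > 1" "1 - 3 * (1 - 1 / K) / 2 = - s"
    using \<rho> by (simp add: s_def, simp add: s_def \<beta> field_simps)
  define C where "C = 4 / (s * \<rho> - 1)"
  have C: "C > 0" using s by (simp add: C_def)
  have "eventually (\<lambda>x. C * (1 + ln x) \<le> x powr (\<epsilon> / 2)) at_top" using C \<epsilon> by real_asymp
  moreover have "eventually (\<lambda>x::real. x \<ge> 4) at_top" by real_asymp
  ultimately show ?thesis using eventually_norm_smooth_exp_sum_le[OF \<delta>(1)]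
  proof eventually_elim
    case (elim x)
    define P where "P = real (smooth_count x (y x))"
    define D where "D = x powr (-1) + x powr (- (s * \<rho> / 2))"
    have D: "D \<ge> 0" by (simp add: D_def)
    have "smooth_moment \<rho> x (y x) \<le>
       (x powr \<delta> * P) powr \<rho> * (4 / (s * \<rho> - 1) * (1 + ln x) * (x powr (-1) + x powr (- (s * \<rho> / 2))))"
    proof (rule smooth_moment_le[OF _ \<rho>(1) s(1)])
      fix \<theta> :: real and a q :: nat
      assume "q > 0" "coprime (int a) (int q)" "real q * (1 + \<bar>\<theta> - real a / real q\<bar> * x) \<le> 4 * sqrt x"
      thus "norm (smooth_exp_sum \<theta> x (y x)) \<le>
          x powr \<delta> * P * (real q * (1 + \<bar>\<theta> - real a / real q\<bar> * x)) powr (- s)"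
        using elim(3)[rule_format, of q "int a" \<theta>] s(2) by (simp add: P_def)
    qed (use elim in \<open>auto simp: P_def\<close>)
    also have "\<dots> = x powr (\<epsilon> / 2) * P powr \<rho> * (C * (1 + ln x) * D)"
    proof -
      have "(x powr \<delta> * P) powr \<rho> = x powr (\<epsilon> / 2) * P powr \<rho>"
        unfolding \<delta>(2)[symmetric] by (simp add: powr_mult powr_powr P_def)
      thus ?thesis by (simp only: C_def D_def)
    qed
    also have "\<dots> \<le> x powr (\<epsilon> / 2) * P powr \<rho> * (x powr (\<epsilon> / 2) * D)"
      using elim D by (intro mult_left_mono mult_right_mono) auto
    also have "\<dots> = (x powr (\<epsilon> / 2) * x powr (\<epsilon> / 2)) * (P powr \<rho> * D)" by simp
    also have "x powr (\<epsilon> / 2) * x powr (\<epsilon> / 2) = x powr \<epsilon>" by (simp flip: powr_add)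
    also have "P powr \<rho> * D = P powr \<rho> * x powr (-1) + P powr \<rho> * x powr (- (\<beta> * \<rho>))"
      by (simp add: D_def s_def distrib_left)
    finally show ?case by (simp add: P_def)
  qed
qed

end

theorem theorem1p1:
  fixes K \<rho> \<kappa> \<beta> :: real and y h :: "real \<Rightarrow> real"
  assumes "K > 3" and "\<rho> > 2"
    and "(h \<longlongrightarrow> 0) at_top"
    and "eventually (\<lambda>x. y x = ln x powr (K + h x)) at_top"
    and "\<kappa> = 1 / K" and "\<beta> = (1 - 3 * \<kappa>) / 4"
    and "\<beta> * \<rho> > 1 / 2"
  shows "\<exists>g. subpolynomial g \<and>
    eventually (\<lambda>x. smooth_moment \<rho> x (y x) \<le>
      g x * (real (smooth_count x (y x)) powr \<rho> * x powr (-1)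
           + real (smooth_count x (y x)) powr \<rho> * x powr (- (\<beta> * \<rho>))
           + real (smooth_count x (y x)) * x powr (3 * (\<rho> - 2) / 4))) at_top"
proof -
  interpret smoothness_bound K y h
    by unfold_locales (use assms in auto)
  define D where "D = (\<lambda>x. real (smooth_count x (y x)) powr \<rho> * x powr (-1)
           + real (smooth_count x (y x)) powr \<rho> * x powr (- (\<beta> * \<rho>))
           + real (smooth_count x (y x)) * x powr (3 * (\<rho> - 2) / 4))"
  \<comment> \<open>Taking the quotient gives one function \<open>g\<close> serving all
    \<open>\<epsilon>\<close> at once. It requires \<open>D x > 0\<close>, which follows from the
    lower bound for the smooth count.\<close>
  define g where "g = (\<lambda>x. smooth_moment \<rho> x (y x) / D x)"
  have \<rho>: "\<rho> > 0" using assms by simp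
  have "eventually (\<lambda>x. x powr (1 - 1 / K - 1 / 2) \<le> real (smooth_count x (y x))) at_top"
    by (rule eventually_smooth_count_ge) auto
  hence pos: "eventually (\<lambda>x. D x > 0) at_top"
    using eventually_gt_at_top[of "0::real"]
  proof eventually_elim
    case (elim x)
    have "0 < x powr (1 - 1 / K - 1 / 2)" using elim by simp
    hence "real (smooth_count x (y x)) > 0" using elim by linarith
    thus ?case unfolding D_def using elim by (intro add_pos_pos mult_pos_pos) auto
  qed
  have "subpolynomial g" unfolding subpolynomial_def
  proof safe
    fix \<epsilon> :: real assume \<epsilon>: "\<epsilon> > 0"
    have \<beta>: "\<beta> = (1 - 3 * (1 / K)) / 4" using assms by simp
    show "eventually (\<lambda>x. \<bar>g x\<bar> \<le> x powr \<epsilon>) at_top"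
      using eventually_smooth_moment_le[OF \<beta> \<rho> assms(7) \<epsilon>] pos
    proof eventually_elim
      case (elim x)
      have "smooth_moment \<rho> x (y x) \<le> x powr \<epsilon> * D x"
        using elim(1) by (rule order.trans) (auto simp: D_def intro!: mult_left_mono)
      hence "g x \<le> x powr \<epsilon>" using elim(2) by (simp add: g_def field_simps)
      moreover have "g x \<ge> 0"
        unfolding g_def using elim(2) \<rho> by (intro divide_nonneg_pos smooth_moment_nonneg)
      ultimately show ?case by simp
    qed
  qed
  moreover have "eventually (\<lambda>x. smooth_moment \<rho> x (y x) \<le> g x * D x) at_top"
    using pos by eventually_elim (simp add: g_def)
  ultimately show ?thesis unfolding D_def by blast
qed

end
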